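(* For the least squares regression problem: (1) any asymptotically exact streaming algorithm for regression working under turnstile updates uses $\Omega(nd)$ memory; (2) any asymptotically exact streaming algorithm for regression working under unique turnstile updates (each coordinate of the input matrix is modified only once) uses $\Omega(nd)$ memory; (3) any asymptotically exact streaming algorithm for regression working under turnstile updates, under the additional assumption that the smallest singular value of the input matrix diverges, uses $\Omega(nd)$ memory.
   Context: Least squares regression: given $A\in\mathbb{R}^{n\times d}$ and $b\in\mathbb{R}^n$, find $\tilde x$ with $\|A\tilde x-b\|\le(1+\varepsilon)\min_{x\in\mathbb{R}^d}\|Ax-b\|$. In the turnstile model, the stream consists of updates, each adding a value to a single entry of $A$ or $b$ (entries start at $0$). An asymptotically exact streaming algorithm for regression is a one-pass algorithm that, on an infinite update stream, after every prefix outputs $\tilde x$ achieving approximation factor $1+\varepsilon$ with $\varepsilon\to0$ as the length of the stream grows, with probability at least $1-\delta$ ($\delta<1/2$). The memory bounds are in bits, in the worst case, for an $n\times d$ input matrix. *)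

theory Defs
  imports
    "HOL-Probability.Probability_Mass_Function"
    "Jordan_Normal_Form.Char_Poly"
begin

type_synonym rmat = "real Matrix.mat"
type_synonym rvec = "real Matrix.vec"

section \<open>Least squares regression\<close>

definition eucl_norm :: "rvec \<Rightarrow> real" where
  "eucl_norm v = sqrt (scalar_prod v v)"

definition reg_cost :: "rmat \<Rightarrow> rvec \<Rightarrow> rvec \<Rightarrow> real" where
  "reg_cost A b x = eucl_norm (A *\<^sub>v x - b)"

definition reg_opt :: "rmat \<Rightarrow> rvec \<Rightarrow> real" where
  "reg_opt A b = (INF x \<in> carrier_vec (dim_col A). reg_cost A b x)"

definition reg_approx :: "real \<Rightarrow> rmat \<Rightarrow> rvec \<Rightarrow> rvec set" where
  "reg_approx \<epsilon> A b =
     {x \<in> carrier_vec (dim_col A). reg_cost A b x \<le> (1 + \<epsilon>) * reg_opt A b}"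

text \<open>An \<open>n \<times> d\<close> matrix has \<open>min n d\<close> singular values (with multiplicity): the square roots of
  the eigenvalues of the smaller of its two Gram matrices.\<close>

definition singular_values :: "rmat \<Rightarrow> real set" where
  "singular_values A = {sqrt k | k. eigenvalue
     (if dim_col A \<le> dim_row A then transpose_mat A * A else A * transpose_mat A) k}"

definition smallest_singular_value :: "rmat \<Rightarrow> real" where
  "smallest_singular_value A = Min (singular_values A)"


section \<open>Update streams\<close>

datatype entry_update = Upd_A nat nat real | Upd_b nat real

fun upd_value :: "entry_update \<Rightarrow> real" where
  "upd_value (Upd_A i j v) = v"
| "upd_value (Upd_b i v) = v"

fun upd_in_range :: "nat \<Rightarrow> nat \<Rightarrow> entry_update \<Rightarrow> bool" where
  "upd_in_range n d (Upd_A i j v) \<longleftrightarrow> i < n \<and> j < d"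
| "upd_in_range n d (Upd_b i v) \<longleftrightarrow> i < n"

fun delta_A :: "entry_update \<Rightarrow> nat \<Rightarrow> nat \<Rightarrow> real" where
  "delta_A (Upd_A i j v) i' j' = (if i = i' \<and> j = j' then v else 0)"
| "delta_A (Upd_b i v) i' j' = 0"

fun delta_b :: "entry_update \<Rightarrow> nat \<Rightarrow> real" where
  "delta_b (Upd_A i j v) i' = 0"
| "delta_b (Upd_b i v) i' = (if i = i' then v else 0)"

type_synonym stream = "nat \<Rightarrow> entry_update"

definition stream_prefix :: "stream \<Rightarrow> nat \<Rightarrow> entry_update list" where
  "stream_prefix \<sigma> t = map \<sigma> [0..<t]"

definition input_A :: "nat \<Rightarrow> nat \<Rightarrow> entry_update list \<Rightarrow> rmat" where
  "input_A n d us = Matrix.mat n d (\<lambda>(i, j). \<Sum>u\<leftarrow>us. delta_A u i j)"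

definition input_b :: "nat \<Rightarrow> entry_update list \<Rightarrow> rvec" where
  "input_b n us = Matrix.vec n (\<lambda>i. \<Sum>u\<leftarrow>us. delta_b u i)"

text \<open>\<open>V\<close> is the set of values that may be added to an entry.\<close>

definition turnstile_streams :: "real set \<Rightarrow> nat \<Rightarrow> nat \<Rightarrow> stream set" where
  "turnstile_streams V n d = {\<sigma>. \<forall>t. upd_in_range n d (\<sigma> t) \<and> upd_value (\<sigma> t) \<in> V}"

text \<open>Uniqueness concerns the coordinates of the input matrix \<open>A\<close>; the right-hand side \<open>b\<close> may be
  updated repeatedly (otherwise an \<open>n \<times> d\<close> instance would admit no infinite stream).\<close>

definition unique_turnstile_streams :: "real set \<Rightarrow> nat \<Rightarrow> nat \<Rightarrow> stream set" where
  "unique_turnstile_streams V n d = {\<sigma> \<in> turnstile_streams V n d.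
     \<forall>s t i j v w. \<sigma> s = Upd_A i j v \<and> \<sigma> t = Upd_A i j w \<longrightarrow> s = t}"

definition diverging_turnstile_streams :: "real set \<Rightarrow> nat \<Rightarrow> nat \<Rightarrow> stream set" where
  "diverging_turnstile_streams V n d = {\<sigma> \<in> turnstile_streams V n d.
     filterlim (\<lambda>t. smallest_singular_value (input_A n d (stream_prefix \<sigma> t))) at_top sequentially}"


section \<open>Streaming algorithms\<close>

text \<open>The whole memory content is a bit string; an update is processed, and an answer is produced,
  from that bit string only, using fresh random bits. Random bits needed later have to be stored.\<close>

record streaming_alg =
  alg_init :: "bool list pmf"
  alg_step :: "entry_update \<Rightarrow> bool list \<Rightarrow> bool list pmf"
  alg_out :: "bool list \<Rightarrow> rvec pmf"

definition run :: "streaming_alg \<Rightarrow> entry_update list \<Rightarrow> bool list pmf" where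
  "run \<A> us = foldl (\<lambda>p u. bind_pmf p (alg_step \<A> u)) (alg_init \<A>) us"

definition answer :: "streaming_alg \<Rightarrow> entry_update list \<Rightarrow> rvec pmf" where
  "answer \<A> us = bind_pmf (run \<A> us) (alg_out \<A>)"

text \<open>The rate \<open>\<epsilon>\<close> may depend on the stream.\<close>

definition asymptotically_exact ::
  "real \<Rightarrow> nat \<Rightarrow> nat \<Rightarrow> stream set \<Rightarrow> streaming_alg \<Rightarrow> bool" where
  "asymptotically_exact \<delta> n d S \<A> \<longleftrightarrow>
     (\<forall>\<sigma>\<in>S. \<exists>\<epsilon>. (\<forall>t. 0 \<le> \<epsilon> t) \<and> \<epsilon> \<longlonglongrightarrow> 0 \<and>
        (\<forall>t. let us = stream_prefix \<sigma> t in
           measure_pmf.prob (answer \<A> us) (reg_approx (\<epsilon> t) (input_A n d us) (input_b n us))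
             \<ge> 1 - \<delta>))"

definition worst_case_memory :: "streaming_alg \<Rightarrow> entry_update list set \<Rightarrow> ereal" where
  "worst_case_memory \<A> P =
     (SUP us \<in> P. SUP s \<in> set_pmf (run \<A> us). ereal (real (length s)))"

definition prefixes_of :: "stream set \<Rightarrow> entry_update list set" where
  "prefixes_of S = {stream_prefix \<sigma> t | \<sigma> t. \<sigma> \<in> S}"

definition small_prefixes_of :: "nat \<Rightarrow> stream set \<Rightarrow> entry_update list set" where
  "small_prefixes_of T S =
     {us \<in> prefixes_of S. length us \<le> T \<and> (\<forall>u \<in> set us. \<bar>upd_value u\<bar> \<le> 1)}"

text \<open>\<open>\<Omega>(nd)\<close> memory for the model \<open>\<S>\<close>, with a constant independent of \<open>n\<close>, \<open>d\<close>, the set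
  \<open>V\<close> of update values and the algorithm. Real updates are the case \<open>V = UNIV\<close>, integer updates
  the case \<open>V = \<int>\<close>. Since \<open>V\<close> is unbounded, the plain worst case over all
  prefixes also counts memory spent on storing large numbers; the second conjunct excludes that
  effect by demanding the bound already for at most \<open>n * d\<close> updates of absolute value at most 1.
  It is confined to \<open>d \<le> n\<close>: for \<open>n = 1\<close> a single nonzero entry of \<open>A\<close> determines an
  optimal solution.\<close>

definition needs_Omega_nd_memory ::
  "real \<Rightarrow> (real set \<Rightarrow> nat \<Rightarrow> nat \<Rightarrow> stream set) \<Rightarrow> bool" where
  "needs_Omega_nd_memory \<delta> \<S> \<longleftrightarrow>
     (\<exists>c>0. \<forall>V n d \<A>. \<int> \<subseteq> V \<and> 1 \<le> n \<and> 1 \<le> d \<and> asymptotically_exact \<delta> n d (\<S> V n d) \<A> \<longrightarrow>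
        ereal (c * real n * real d) \<le> worst_case_memory \<A> (prefixes_of (\<S> V n d)) \<and>
        (d \<le> n \<longrightarrow> ereal (c * real n * real d) \<le>
           worst_case_memory \<A> (small_prefixes_of (n * d) (\<S> V n d))))"

end

theory Submission
  imports
    Defs
    "HOL-Combinatorics.Transposition"
    "HOL-Library.Omega_Words_Fun"
    "HOL-Probability.Hoeffding"
    "Jordan_Normal_Form.Spectral_Radius"
begin

text \<open>All three bounds are reductions from the one-way communication problem INDEX: Alice encodes
  signs in the entries of \<open>A\<close>, the memory content is her message, and Bob continues the stream so
  that a nearly optimal solution reveals the sign he asks for. INDEX on \<open>m\<close> bits with error
  \<open>\<delta> < 1 / 2\<close> needs \<open>\<Omega>(m)\<close> bits. There are finitely many inputs of Alice, so Bob can wait until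
  \<open>\<epsilon>\<close> is below any fixed threshold for all of them.

  Bob anchors columns: he adds \<open>N\<close> times a partial permutation matrix to Alice's matrix \<open>B\<close>. If the
  gradient \<open>A\<^sup>T (A y - b)\<close> is small for an explicit \<open>y\<close>, every nearly optimal solution is close to
  \<open>y\<close>. For unique updates, the anchors lie below Alice's block and \<open>b = e\<^sub>i\<close>; then
  \<open>y = B\<^sup>T e\<^sub>i / N\<^sup>2\<close>. If the smallest singular value has to diverge, \<open>N\<close> must grow along the stream,
  and the threshold on \<open>\<epsilon>\<close> may not depend on it. Bob then anchors all columns, column \<open>j\<close> in row
  \<open>i\<close>, and sets \<open>b = N e\<^sub>i\<close>; now \<open>y\<^sub>j = 1 - B\<^sub>i\<^sub>j / N\<close>.

  The bound over all prefixes, for arbitrary \<open>n\<close> and \<open>d\<close>, is cheaper: with \<open>A\<^sub>0\<^sub>0 = a\<close> as the only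
  nonzero entry and \<open>b = e\<^sub>0\<close> the system is consistent, so that \<open>x\<^sub>0 = 1 / a\<close> exactly.\<close>

unbundle no vec_syntax
unbundle no inner_syntax

section \<open>One-way communication complexity of INDEX\<close>

text \<open>The success probability for the bit \<open>i \<in> x\<close> of a strategy that claims \<open>i \<in> x\<close> with
  probability \<open>q i\<close>.\<close>

definition guess_prob :: "('i \<Rightarrow> real) \<Rightarrow> 'i set \<Rightarrow> 'i \<Rightarrow> real" where
  "guess_prob q x i = (if i \<in> x then q i else 1 - q i)"

lemma prob_well_guessed_le:
  fixes q :: "'i \<Rightarrow> real" and \<gamma> :: real
  assumes I: "finite I" "I \<noteq> {}" and q: "\<And>i. i \<in> I \<Longrightarrow> q i \<in> {0..1}" and \<gamma>: "0 \<le> \<gamma>"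
  shows "measure_pmf.prob (pmf_of_set (Pow I)) {x. (1 / 2 + \<gamma>) * card I \<le> (\<Sum>i\<in>I. guess_prob q x i)}
           \<le> exp (- 2 * \<gamma>\<^sup>2 * card I)" (is "measure_pmf.prob _ ?W \<le> _")
proof -
  define m where "m = real (card I)"
  have m: "0 < m" using I by (simp add: m_def card_gt_0_iff)
  define coins where "coins = Pi_pmf I False (\<lambda>_. bernoulli_pmf (1 / 2))"
  define X where "X = (\<lambda>i (b :: 'i \<Rightarrow> bool). if b i then q i else 1 - q i)"
  have mean: "measure_pmf.expectation coins (X i) = 1 / 2" if "i \<in> I" for i
  proof -
    have "measure_pmf.expectation coins (X i)
        = measure_pmf.expectation (map_pmf (\<lambda>b. b i) coins) (\<lambda>c. if c then q i else 1 - q i)"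
      by (simp add: X_def)
    also have "\<dots> = q i / 2 + (1 - q i) / 2"
      using I that by (simp add: coins_def Pi_pmf_component)
    also have "\<dots> = 1 / 2" by (simp flip: add_divide_distrib)
    finally show ?thesis .
  qed
  interpret Hoeffding_ineq "measure_pmf coins" I X "\<lambda>_. 0" "\<lambda>_. 1" "m / 2"
  proof unfold_locales
    show "prob_space.indep_vars (measure_pmf coins) (\<lambda>_. borel) X I"
      unfolding X_def coins_def using I
      by (intro prob_space.indep_vars_compose2[OF _ indep_vars_Pi_pmf] prob_space_measure_pmf) auto
    show "m / 2 \<equiv> \<Sum>i\<in>I. measure_pmf.expectation coins (X i)"
      by (rule eq_reflection) (simp add: mean m_def)
  qed (use I q in \<open>auto simp: X_def\<close>)
  have "measure_pmf.prob (pmf_of_set (Pow I)) ?W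
      = measure_pmf.prob coins ((\<lambda>b. {i \<in> I. b i}) -` ?W)"
    unfolding coins_def by (simp flip: pmf_of_set_Pow_conv_bernoulli[OF I(1), where P = False])
  also have "(\<lambda>b. {i \<in> I. b i}) -` ?W
      = {b \<in> space (measure_pmf coins). m / 2 + \<gamma> * m \<le> (\<Sum>i\<in>I. X i b)}"
    by (auto simp: X_def guess_prob_def m_def algebra_simps cong: sum.cong)
  also have "measure_pmf.prob coins \<dots> \<le> exp (- 2 * (\<gamma> * m)\<^sup>2 / (\<Sum>i\<in>I. (1 - 0)\<^sup>2))"
    using \<gamma> m by (intro Hoeffding_ineq_ge) (auto simp: m_def)
  also have "- 2 * (\<gamma> * m)\<^sup>2 / (\<Sum>i\<in>I. (1 - 0)\<^sup>2) = - 2 * \<gamma>\<^sup>2 * card I"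
    using m by (simp add: m_def power2_eq_square)
  finally show ?thesis .
qed

lemma card_well_guessed_le:
  fixes q :: "'i \<Rightarrow> real" and \<gamma> :: real
  assumes I: "finite I" and q: "\<And>i. i \<in> I \<Longrightarrow> q i \<in> {0..1}" and \<gamma>: "0 \<le> \<gamma>"
  shows "real (card {x \<in> Pow I. (1 / 2 + \<gamma>) * card I \<le> (\<Sum>i\<in>I. guess_prob q x i)})
           \<le> 2 ^ card I * exp (- 2 * \<gamma>\<^sup>2 * card I)"
proof (cases "I = {}")
  case False
  define W where "W = {x. (1 / 2 + \<gamma>) * card I \<le> (\<Sum>i\<in>I. guess_prob q x i)}"
  have "real (card (Pow I \<inter> W)) / 2 ^ card I = measure_pmf.prob (pmf_of_set (Pow I)) W"
    using I by (subst measure_pmf_of_set) (auto simp: card_Pow)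
  also have "\<dots> \<le> exp (- 2 * \<gamma>\<^sup>2 * card I)"
    unfolding W_def using I False q \<gamma> by (rule prob_well_guessed_le)
  finally have "real (card (Pow I \<inter> W)) \<le> 2 ^ card I * exp (- 2 * \<gamma>\<^sup>2 * card I)"
    by (simp add: field_simps)
  also have "Pow I \<inter> W = {x \<in> Pow I. (1 / 2 + \<gamma>) * card I \<le> (\<Sum>i\<in>I. guess_prob q x i)}"
    by (auto simp: W_def)
  finally show ?thesis .
qed simp

lemma pmf_ex_ge_expectation:
  fixes f :: "'a \<Rightarrow> real"
  assumes "integrable (measure_pmf p) f"
  shows "\<exists>s\<in>set_pmf p. measure_pmf.expectation p f \<le> f s"
proof (rule ccontr)
  assume "\<not> ?thesis"
  then have "AE s in measure_pmf p. f s < measure_pmf.expectation p f"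
    by (auto simp: AE_measure_pmf_iff not_le)
  with assms have "measure_pmf.expectation p f < measure_pmf.expectation p f"
    by (rule measure_pmf.expectation_less)
  then show False by simp
qed

text \<open>Some message of \<open>x\<close> is as good as the average one, and each message is good for few \<open>x\<close>.\<close>

lemma index_card_messages_ge:
  fixes msg :: "'i set \<Rightarrow> 'm pmf" and q :: "'m \<Rightarrow> 'i \<Rightarrow> real"
  assumes I: "finite I" and M: "finite M" "\<And>x. x \<subseteq> I \<Longrightarrow> set_pmf (msg x) \<subseteq> M"
    and q: "\<And>s i. s \<in> M \<Longrightarrow> i \<in> I \<Longrightarrow> q s i \<in> {0..1}" and \<delta>: "\<delta> \<le> 1 / 2"
    and success: "\<And>x i. x \<subseteq> I \<Longrightarrow> i \<in> I \<Longrightarrow>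
      1 - \<delta> \<le> measure_pmf.expectation (msg x) (\<lambda>s. guess_prob (q s) x i)"
  shows "exp (2 * (1 / 2 - \<delta>)\<^sup>2 * card I) \<le> card M"
proof -
  define \<gamma> where "\<gamma> = 1 / 2 - \<delta>"
  define W where "W s = {x \<in> Pow I. (1 / 2 + \<gamma>) * card I \<le> (\<Sum>i\<in>I. guess_prob (q s) x i)}" for s
  have "\<exists>s\<in>M. x \<in> W s" if x: "x \<subseteq> I" for x
  proof -
    have int: "integrable (measure_pmf (msg x)) f" for f :: "'m \<Rightarrow> real"
      using M x by (intro integrable_measure_pmf_finite) (auto dest: finite_subset)
    have "(1 / 2 + \<gamma>) * card I = (\<Sum>i\<in>I. 1 - \<delta>)" by (simp add: \<gamma>_def)
    also have "\<dots> \<le> (\<Sum>i\<in>I. measure_pmf.expectation (msg x) (\<lambda>s. guess_prob (q s) x i))"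
      using success[OF x] by (rule sum_mono)
    also have "\<dots> = measure_pmf.expectation (msg x) (\<lambda>s. \<Sum>i\<in>I. guess_prob (q s) x i)"
      by (rule Bochner_Integration.integral_sum[symmetric]) (rule int)
    finally show ?thesis
      using pmf_ex_ge_expectation[OF int[of "\<lambda>s. \<Sum>i\<in>I. guess_prob (q s) x i"]] M(2)[OF x] x
      by (force simp: W_def)
  qed
  then have "card (Pow I) \<le> card (\<Union>s\<in>M. W s)"
    using I M(1) by (intro card_mono) (auto simp: W_def)
  also have "\<dots> \<le> (\<Sum>s\<in>M. card (W s))" by (rule card_UN_le[OF M(1)])
  finally have "2 ^ card I \<le> (\<Sum>s\<in>M. real (card (W s)))"
    using I by (simp add: card_Pow flip: of_nat_sum)
  also have "\<dots> \<le> (\<Sum>s\<in>M. 2 ^ card I * exp (- 2 * \<gamma>\<^sup>2 * card I))"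
  proof (rule sum_mono)
    fix s assume "s \<in> M"
    then show "real (card (W s)) \<le> 2 ^ card I * exp (- 2 * \<gamma>\<^sup>2 * card I)"
      unfolding W_def using \<delta> by (intro card_well_guessed_le I q) (auto simp: \<gamma>_def)
  qed
  finally have "1 \<le> card M * exp (- 2 * \<gamma>\<^sup>2 * card I)" by simp
  then show ?thesis by (simp add: \<gamma>_def exp_minus field_simps)
qed

lemma finite_bool_lists_length_le: "finite {s :: bool list. length s \<le> L}"
  using finite_lists_length_le[of "UNIV :: bool set" L] by simp

lemma card_bool_lists_length_le: "card {s :: bool list. length s \<le> L} \<le> 4 ^ L"
proof -
  have "card {s :: bool list. length s \<le> L} = (\<Sum>i<Suc L. 2 ^ i)"
    using card_lists_length_le[of "UNIV :: bool set" L] by (simp add: lessThan_Suc_atMost)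
  also have "\<dots> = 2 * 2 ^ L - 1"
    using sum_power2[of "Suc L"] by (simp add: lessThan_atLeast0)
  also have "\<dots> \<le> 2 ^ L * 2 ^ L"
  proof -
    have "0 \<le> (2 ^ L - 1 :: int)\<^sup>2" by simp
    then have "2 * 2 ^ L - 1 \<le> (2 ^ L * 2 ^ L :: int)" by (simp add: power2_eq_square algebra_simps)
    then have "int (2 * 2 ^ L) \<le> int (2 ^ L * 2 ^ L + 1)" by simp
    then show ?thesis by (simp only: of_nat_le_iff)
  qed
  finally show ?thesis by (simp flip: power_mult_distrib)
qed

section \<open>Memory as a one-way message\<close>

definition correct_answers :: "('i \<Rightarrow> 'a set) \<Rightarrow> 'i set \<Rightarrow> 'i \<Rightarrow> 'a set" where
  "correct_answers dec x i = (if i \<in> x then dec i else - dec i)"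

lemma mem_correct_answers_iff: "z \<in> correct_answers dec x i \<longleftrightarrow> (z \<in> dec i \<longleftrightarrow> i \<in> x)"
  by (simp add: correct_answers_def)

definition answer_from :: "streaming_alg \<Rightarrow> entry_update list \<Rightarrow> bool list \<Rightarrow> rvec pmf" where
  "answer_from \<A> us s =
     bind_pmf (foldl (\<lambda>p u. bind_pmf p (alg_step \<A> u)) (return_pmf s) us) (alg_out \<A>)"

lemma foldl_bind_pmf:
  "foldl (\<lambda>p u. bind_pmf p (f u)) p us
     = bind_pmf p (\<lambda>s. foldl (\<lambda>p u. bind_pmf p (f u)) (return_pmf s) us)"
proof (induction us rule: rev_induct)
  case (snoc u us)
  then show ?case by (simp add: bind_assoc_pmf)
qed (simp add: bind_return_pmf')

lemma answer_append: "answer \<A> (us @ vs) = bind_pmf (run \<A> us) (answer_from \<A> vs)"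
  unfolding answer_def answer_from_def run_def foldl_append
  by (subst foldl_bind_pmf) (simp add: bind_assoc_pmf)

lemma measure_bind_pmf:
  "measure_pmf.prob (bind_pmf p f) X = measure_pmf.expectation p (\<lambda>s. measure_pmf.prob (f s) X)"
  unfolding measure_pmf_bind
  by (subst measure_pmf.measure_bind[where N = "count_space UNIV"])
     (auto simp: measure_pmf_in_subprob_algebra space_subprob_algebra
       intro!: measure_pmf.subprob_space_axioms)

lemma index_message_length_ge:
  fixes enc :: "'i set \<Rightarrow> entry_update list" and suf :: "'i \<Rightarrow> entry_update list"
    and dec :: "'i \<Rightarrow> rvec set"
  assumes I: "finite I" and \<delta>: "\<delta> \<le> 1 / 2"
    and short: "\<And>x s. x \<subseteq> I \<Longrightarrow> s \<in> set_pmf (run \<A> (enc x)) \<Longrightarrow> length s \<le> L"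
    and dec: "\<And>x i. x \<subseteq> I \<Longrightarrow> i \<in> I \<Longrightarrow>
      1 - \<delta> \<le> measure_pmf.prob (answer \<A> (enc x @ suf i)) (correct_answers dec x i)"
  shows "(1 / 2 - \<delta>)\<^sup>2 * card I \<le> L"
proof -
  define M where "M = {s :: bool list. length s \<le> L}"
  define q where "q s i = measure_pmf.prob (answer_from \<A> (suf i) s) (dec i)" for s i
  have "exp (2 * (1 / 2 - \<delta>)\<^sup>2 * card I) \<le> card M"
  proof (rule index_card_messages_ge[where msg = "\<lambda>x. run \<A> (enc x)" and q = q])
    fix x i assume x: "x \<subseteq> I" and i: "i \<in> I"
    have "guess_prob (q s) x i
        = measure_pmf.prob (answer_from \<A> (suf i) s) (correct_answers dec x i)" for s
      by (simp add: q_def guess_prob_def correct_answers_def Compl_eq_Diff_UNIV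
          measure_pmf.prob_compl[of "dec i", simplified])
    then show "1 - \<delta> \<le> measure_pmf.expectation (run \<A> (enc x)) (\<lambda>s. guess_prob (q s) x i)"
      using dec[OF x i] by (simp only: answer_append measure_bind_pmf)
  qed (use I \<delta> short in \<open>auto simp: M_def q_def finite_bool_lists_length_le\<close>)
  also have "\<dots> \<le> 4 ^ L"
    using of_nat_mono[OF card_bool_lists_length_le[of L], where ?'a = real] by (simp add: M_def)
  also have "\<dots> = 2 ^ (2 * L)" by (simp add: power_mult)
  also have "\<dots> \<le> exp 1 ^ (2 * L)"
    using exp_ge_add_one_self[of 1] by (intro power_mono) auto
  also have "\<dots> = exp (2 * L)" by (simp flip: exp_of_nat_mult)
  finally show ?thesis by simp
qed

lemma index_memory_ge:
  fixes enc :: "'i set \<Rightarrow> entry_update list" and suf :: "'i \<Rightarrow> entry_update list"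
    and dec :: "'i \<Rightarrow> rvec set"
  assumes I: "finite I" and \<delta>: "\<delta> \<le> 1 / 2"
    and P: "\<And>x. x \<subseteq> I \<Longrightarrow> enc x \<in> P"
    and dec: "\<And>x i. x \<subseteq> I \<Longrightarrow> i \<in> I \<Longrightarrow>
      1 - \<delta> \<le> measure_pmf.prob (answer \<A> (enc x @ suf i)) (correct_answers dec x i)"
  shows "ereal ((1 / 2 - \<delta>)\<^sup>2 * card I) \<le> worst_case_memory \<A> P"
proof (rule ccontr)
  define B where "B = (1 / 2 - \<delta>)\<^sup>2 * card I"
  assume "\<not> ?thesis"
  then have less: "worst_case_memory \<A> P < ereal B" by (simp add: B_def)
  have short: "real (length s) < B" if x: "x \<subseteq> I" and s: "s \<in> set_pmf (run \<A> (enc x))" for x s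
  proof -
    have "ereal (length s) \<le> worst_case_memory \<A> P"
      unfolding worst_case_memory_def by (rule SUP_upper2[OF P[OF x]], rule SUP_upper[OF s])
    with less show ?thesis by (metis less_ereal.simps(1) order.strict_trans1)
  qed
  define L where "L = nat (\<lceil>B\<rceil> - 1)"
  obtain s where "s \<in> set_pmf (run \<A> (enc {}))" using set_pmf_not_empty by fastforce
  then have "0 < B" using short[of "{}" s] by simp
  then have "real L < B" by (simp add: L_def) linarith
  moreover have "B \<le> L"
    unfolding B_def
  proof (rule index_message_length_ge[OF I \<delta> _ dec])
    fix x s assume "x \<subseteq> I" "s \<in> set_pmf (run \<A> (enc x))"
    then have "real (length s) < B" by (rule short)
    then show "length s \<le> L" by (simp add: L_def) linarith
  qed
  ultimately show False by simp
qed

section \<open>Euclidean norm and diagonal dominance\<close>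

lemma eucl_norm_nonneg: "0 \<le> eucl_norm v"
  by (simp add: eucl_norm_def scalar_prod_def sum_nonneg)

lemma eucl_norm_power2: "(eucl_norm v)\<^sup>2 = v \<bullet> v"
  by (simp add: eucl_norm_def scalar_prod_def sum_nonneg)

lemma eucl_norm_power2_eq_sum: "v \<in> carrier_vec n \<Longrightarrow> (eucl_norm v)\<^sup>2 = (\<Sum>k<n. (v $ k)\<^sup>2)"
  unfolding eucl_norm_power2 by (simp add: scalar_prod_def power2_eq_square lessThan_atLeast0)

lemma abs_index_le_eucl_norm:
  assumes "v \<in> carrier_vec n" "k < n"
  shows "\<bar>v $ k\<bar> \<le> eucl_norm v"
proof (rule power2_le_imp_le)
  have "(v $ k)\<^sup>2 \<le> (\<Sum>k<n. (v $ k)\<^sup>2)"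
    using assms(2) by (intro member_le_sum) auto
  then show "\<bar>v $ k\<bar>\<^sup>2 \<le> (eucl_norm v)\<^sup>2"
    by (simp add: eucl_norm_power2_eq_sum[OF assms(1)])
qed (rule eucl_norm_nonneg)

lemma eucl_norm_le:
  assumes v: "v \<in> carrier_vec n" and B: "\<And>k. k < n \<Longrightarrow> \<bar>v $ k\<bar> \<le> B" "0 \<le> B"
  shows "eucl_norm v \<le> sqrt n * B"
proof (rule power2_le_imp_le)
  have "(eucl_norm v)\<^sup>2 \<le> (\<Sum>k<n. B\<^sup>2)"
    unfolding eucl_norm_power2_eq_sum[OF v]
    using B by (intro sum_mono) (simp flip: abs_le_square_iff)
  then show "(eucl_norm v)\<^sup>2 \<le> (sqrt n * B)\<^sup>2" by (simp add: power_mult_distrib)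
qed (use B in simp)

lemma eucl_norm_eq_0_iff:
  assumes "v \<in> carrier_vec n"
  shows "eucl_norm v = 0 \<longleftrightarrow> v = 0\<^sub>v n"
  using assms by (auto simp: eucl_norm_def conjugate_square_eq_0_vec[where 'a = real, simplified])

lemma row_dominant_mult_vec_ge:
  fixes M :: rmat
  assumes M: "M \<in> carrier_mat p k" and v: "v \<in> carrier_vec k" and c: "c < k"
    and \<rho>: "\<And>c. c < k \<Longrightarrow> \<rho> c < p"
    and dominant: "\<And>c. c < k \<Longrightarrow> \<kappa> + (\<Sum>c'\<in>{..<k} - {c}. \<bar>M $$ (\<rho> c, c')\<bar>) \<le> \<bar>M $$ (\<rho> c, c)\<bar>"
    and \<kappa>: "0 \<le> \<kappa>"
  shows "\<kappa> * \<bar>v $ c\<bar> \<le> eucl_norm (M *\<^sub>v v)"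
proof -
  define V where "V = Max ((\<lambda>c. \<bar>v $ c\<bar>) ` {..<k})"
  have "V \<in> (\<lambda>c. \<bar>v $ c\<bar>) ` {..<k}" unfolding V_def using c by (intro Max_in) auto
  then obtain m where m: "m < k" "V = \<bar>v $ m\<bar>" by auto
  have V: "\<bar>v $ c'\<bar> \<le> V" if "c' < k" for c'
    unfolding V_def using that by (intro Max_ge) auto
  define R where "R = (\<Sum>c'\<in>{..<k} - {m}. M $$ (\<rho> m, c') * v $ c')"
  have "(M *\<^sub>v v) $ \<rho> m = (\<Sum>c'<k. M $$ (\<rho> m, c') * v $ c')"
    using M v \<rho>[OF m(1)] by (auto simp: scalar_prod_def lessThan_atLeast0 intro!: sum.cong)
  then have Mv: "(M *\<^sub>v v) $ \<rho> m = M $$ (\<rho> m, m) * v $ m + R"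
    using m(1) by (simp add: sum.remove[of "{..<k}" m] R_def)
  have "\<bar>R\<bar> \<le> (\<Sum>c'\<in>{..<k} - {m}. \<bar>M $$ (\<rho> m, c') * v $ c'\<bar>)" unfolding R_def by (rule sum_abs)
  also have "\<dots> \<le> (\<Sum>c'\<in>{..<k} - {m}. \<bar>M $$ (\<rho> m, c')\<bar> * V)"
    unfolding abs_mult using V by (intro sum_mono mult_left_mono) auto
  finally have R: "\<bar>R\<bar> \<le> (\<Sum>c'\<in>{..<k} - {m}. \<bar>M $$ (\<rho> m, c')\<bar>) * V"
    by (simp add: sum_distrib_right)
  have "\<kappa> * \<bar>v $ c\<bar> \<le> \<kappa> * V" using V[OF c] \<kappa> by (rule mult_left_mono)
  also have "\<dots> \<le> (\<bar>M $$ (\<rho> m, m)\<bar> - (\<Sum>c'\<in>{..<k} - {m}. \<bar>M $$ (\<rho> m, c')\<bar>)) * V"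
    using dominant[OF m(1)] m(2) by (intro mult_right_mono) auto
  also have "\<dots> \<le> \<bar>M $$ (\<rho> m, m) * v $ m\<bar> - \<bar>R\<bar>"
    using R by (simp add: m(2) abs_mult left_diff_distrib)
  also have "\<dots> \<le> \<bar>(M *\<^sub>v v) $ \<rho> m\<bar>" unfolding Mv by linarith
  also have "\<dots> \<le> eucl_norm (M *\<^sub>v v)"
    using mult_mat_vec_carrier[OF M v] \<rho>[OF m(1)] by (rule abs_index_le_eucl_norm)
  finally show ?thesis .
qed

section \<open>Approximately optimal solutions\<close>

lemma reg_cost_nonneg: "0 \<le> reg_cost A b z"
  by (simp add: reg_cost_def eucl_norm_nonneg)

lemma reg_opt_le: "z \<in> carrier_vec (dim_col A) \<Longrightarrow> reg_opt A b \<le> reg_cost A b z"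
  unfolding reg_opt_def by (rule cINF_lower) (auto intro!: bdd_belowI[of _ 0] simp: reg_cost_nonneg)

lemma reg_opt_nonneg: "0 \<le> reg_opt A b"
  unfolding reg_opt_def
  by (rule cINF_greatest) (metis empty_iff zero_carrier_vec, rule reg_cost_nonneg)

lemma reg_approx_mono: "\<epsilon> \<le> \<epsilon>' \<Longrightarrow> reg_approx \<epsilon> A b \<subseteq> reg_approx \<epsilon>' A b"
  unfolding reg_approx_def using reg_opt_nonneg[of A b]
  by (auto elim!: order_trans intro: mult_right_mono)

lemma reg_approx_cost_le:
  assumes "z \<in> reg_approx \<epsilon> A b" "0 \<le> \<epsilon>" "y \<in> carrier_vec (dim_col A)"
  shows "reg_cost A b z \<le> (1 + \<epsilon>) * reg_cost A b y"
  using assms reg_opt_le[OF assms(3), of b]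
  by (auto simp: reg_approx_def elim!: order_trans intro!: mult_left_mono)

lemma reg_approx_consistent:
  assumes A: "A \<in> carrier_mat n d" and b: "b \<in> carrier_vec n"
    and y: "y \<in> carrier_vec d" "A *\<^sub>v y = b" and z: "z \<in> reg_approx \<epsilon> A b"
  shows "A *\<^sub>v z = b"
proof -
  have "reg_cost A b y = 0" using b y by (simp add: reg_cost_def eucl_norm_def)
  then have "reg_opt A b = 0"
    using reg_opt_le[of y A b] reg_opt_nonneg[of A b] y A by auto
  then have "reg_cost A b z = 0" and zc: "z \<in> carrier_vec d"
    using z A reg_cost_nonneg[of A b z] by (auto simp: reg_approx_def)
  then have *: "A *\<^sub>v z - b = 0\<^sub>v n"
    using A b by (simp add: reg_cost_def eucl_norm_eq_0_iff[where n = n])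
  show ?thesis
  proof (rule eq_vecI)
    fix k assume "k < dim_vec b"
    then show "(A *\<^sub>v z) $ k = b $ k" using arg_cong[OF *, of "\<lambda>v. v $ k"] A b by simp
  qed (use A b in simp)
qed

lemma reg_cost_add_power2:
  assumes A: "A \<in> carrier_mat n d" and b: "b \<in> carrier_vec n"
    and y: "y \<in> carrier_vec d" and h: "h \<in> carrier_vec d"
  shows "(reg_cost A b (y + h))\<^sup>2 = (reg_cost A b y)\<^sup>2
    + 2 * ((transpose_mat A *\<^sub>v (A *\<^sub>v y - b)) \<bullet> h) + (eucl_norm (A *\<^sub>v h))\<^sup>2"
proof -
  define r where "r = A *\<^sub>v y - b"
  define u where "u = A *\<^sub>v h"
  have r: "r \<in> carrier_vec n" and u: "u \<in> carrier_vec n" using A b y h by (auto simp: r_def u_def)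
  have "A *\<^sub>v (y + h) - b = r + u"
    using A b y h by (auto simp: r_def u_def mult_add_distrib_mat_vec[OF A y h])
  then have "(reg_cost A b (y + h))\<^sup>2 = (r + u) \<bullet> (r + u)"
    by (simp add: reg_cost_def eucl_norm_power2)
  also have "\<dots> = r \<bullet> r + 2 * (r \<bullet> u) + u \<bullet> u"
    using r u by (simp add: add_scalar_prod_distrib[of _ n] scalar_prod_add_distrib[of _ n]
        comm_scalar_prod[of u n r])
  also have "r \<bullet> u = (transpose_mat A *\<^sub>v r) \<bullet> h"
    unfolding u_def by (rule transpose_vec_mult_scalar[OF A h r, symmetric])
  finally show ?thesis by (simp add: reg_cost_def eucl_norm_power2 r_def u_def)
qed

lemma reg_approx_power2_eucl_norm_diff_le:
  assumes A: "A \<in> carrier_mat n d" and b: "b \<in> carrier_vec n" and y: "y \<in> carrier_vec d"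
    and z: "z \<in> reg_approx \<epsilon> A b" and \<epsilon>: "0 \<le> \<epsilon>" "\<epsilon> \<le> 1"
  shows "(eucl_norm (A *\<^sub>v (z - y)))\<^sup>2
    \<le> 3 * \<epsilon> * (reg_cost A b y)\<^sup>2 - 2 * ((transpose_mat A *\<^sub>v (A *\<^sub>v y - b)) \<bullet> (z - y))"
proof -
  have zc: "z \<in> carrier_vec d" using z A by (simp add: reg_approx_def)
  then have zy: "y + (z - y) = z" using y by (intro eq_vecI) auto
  have "(reg_cost A b z)\<^sup>2 \<le> ((1 + \<epsilon>) * reg_cost A b y)\<^sup>2"
    using reg_approx_cost_le[OF z \<epsilon>(1), of y] y A reg_cost_nonneg by (intro power_mono) auto
  also have "\<dots> = (reg_cost A b y)\<^sup>2 + (2 * \<epsilon> + \<epsilon> * \<epsilon>) * (reg_cost A b y)\<^sup>2"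
    by (simp add: power_mult_distrib power2_eq_square algebra_simps)
  also have "\<dots> \<le> (reg_cost A b y)\<^sup>2 + (2 * \<epsilon> + \<epsilon>) * (reg_cost A b y)\<^sup>2"
    using \<epsilon> by (intro add_left_mono mult_right_mono add_left_mono) (auto simp: mult_left_le)
  finally show ?thesis
    using reg_cost_add_power2[OF A b y, of "z - y"] y zc by (simp add: zy)
qed

text \<open>Here \<open>q\<close> is the value at \<open>z - y\<close> of a seminorm dominated by \<open>A\<close>. The proof completes the
  square.\<close>

lemma reg_approx_near:
  assumes A: "A \<in> carrier_mat n d" and b: "b \<in> carrier_vec n" and y: "y \<in> carrier_vec d"
    and z: "z \<in> reg_approx \<epsilon> A b" and \<epsilon>: "0 \<le> \<epsilon>" "\<epsilon> \<le> 1"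
    and \<kappa>: "0 < \<kappa>" "\<kappa> * q \<le> eucl_norm (A *\<^sub>v (z - y))"
    and \<gamma>: "\<bar>(transpose_mat A *\<^sub>v (A *\<^sub>v y - b)) \<bullet> (z - y)\<bar> \<le> \<gamma> * q" "0 \<le> \<gamma>"
  shows "q \<le> 2 * \<gamma> / \<kappa>\<^sup>2 + sqrt (3 * \<epsilon>) * reg_cost A b y / \<kappa>"
proof (rule ccontr)
  define t where "t = sqrt (3 * \<epsilon>) * reg_cost A b y"
  have t: "0 \<le> t" "t\<^sup>2 = 3 * \<epsilon> * (reg_cost A b y)\<^sup>2"
    using \<epsilon> by (simp_all add: t_def reg_cost_nonneg power_mult_distrib)
  have norm_diff_le: "(eucl_norm (A *\<^sub>v (z - y)))\<^sup>2 \<le> t\<^sup>2 + 2 * (\<gamma> * q)"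
    using reg_approx_power2_eucl_norm_diff_le[OF A b y z \<epsilon>] \<gamma>(1) by (simp add: t abs_le_iff)
  assume "\<not> ?thesis"
  then have q_gt: "2 * \<gamma> / \<kappa>\<^sup>2 + t / \<kappa> < q" by (simp add: t_def)
  moreover have "0 \<le> 2 * \<gamma> / \<kappa>\<^sup>2 + t / \<kappa>" using \<kappa>(1) \<gamma>(2) t(1) by simp
  ultimately have q: "0 < q" by linarith
  have \<kappa>q_gt: "2 * \<gamma> / \<kappa> + t < \<kappa> * q"
    using mult_strict_left_mono[OF q_gt \<kappa>(1)] \<kappa>(1) by (simp add: power2_eq_square distrib_left)
  have "t\<^sup>2 + 2 * (\<gamma> * q) \<le> t * (\<kappa> * q) + 2 * \<gamma> / \<kappa> * (\<kappa> * q)"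
  proof -
    have "0 \<le> 2 * \<gamma> / \<kappa>" using \<kappa>(1) \<gamma>(2) by simp
    then have "t \<le> \<kappa> * q" using \<kappa>q_gt by linarith
    then show ?thesis using t(1) \<kappa>(1) by (simp add: power2_eq_square mult_left_mono)
  qed
  also have "\<dots> < (\<kappa> * q) * (\<kappa> * q)"
    using mult_strict_right_mono[OF \<kappa>q_gt, of "\<kappa> * q"] \<kappa>(1) q by (simp add: algebra_simps)
  also have "\<dots> \<le> (eucl_norm (A *\<^sub>v (z - y)))\<^sup>2"
    using power_mono[OF \<kappa>(2), of 2] \<kappa>(1) q by (simp add: power2_eq_square)
  finally show False using norm_diff_le by simp
qed

lemma reg_approx_index_near:
  fixes d k :: nat and h :: real
  assumes A: "A \<in> carrier_mat n d" and b: "b \<in> carrier_vec n" and y: "y \<in> carrier_vec d"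
    and z: "z \<in> reg_approx \<epsilon> A b" and \<epsilon>: "0 \<le> \<epsilon>" "\<epsilon> \<le> 1" and k: "k \<le> d" and j: "j < k"
    and \<kappa>: "0 < \<kappa>" "\<And>v c. v \<in> carrier_vec d \<Longrightarrow> c < k \<Longrightarrow> \<kappa> * \<bar>v $ c\<bar> \<le> eucl_norm (A *\<^sub>v v)"
    and grad: "\<And>c. c < k \<Longrightarrow> \<bar>(transpose_mat A *\<^sub>v (A *\<^sub>v y - b)) $ c\<bar> \<le> h"
      "\<And>c. k \<le> c \<Longrightarrow> c < d \<Longrightarrow> (transpose_mat A *\<^sub>v (A *\<^sub>v y - b)) $ c = 0"
  shows "\<bar>z $ j - y $ j\<bar> \<le> 2 * (k * h) / \<kappa>\<^sup>2 + sqrt (3 * \<epsilon>) * reg_cost A b y / \<kappa>"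
proof -
  define v where "v = z - y"
  define g where "g = transpose_mat A *\<^sub>v (A *\<^sub>v y - b)"
  define q where "q = Max ((\<lambda>c. \<bar>v $ c\<bar>) ` {..<k})"
  have v: "v \<in> carrier_vec d" using z A y by (auto simp: v_def reg_approx_def)
  have q: "\<bar>v $ c\<bar> \<le> q" if "c < k" for c
    unfolding q_def using that by (intro Max_ge) auto
  have "q \<in> (\<lambda>c. \<bar>v $ c\<bar>) ` {..<k}" unfolding q_def using j by (intro Max_in) auto
  then have \<kappa>q: "\<kappa> * q \<le> eucl_norm (A *\<^sub>v v)" using \<kappa>(2)[OF v] by auto
  have h: "0 \<le> h" using grad(1)[OF j] by linarith
  have "g \<bullet> v = (\<Sum>c<d. g $ c * v $ c)" using v by (simp add: scalar_prod_def lessThan_atLeast0)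
  also have "\<dots> = (\<Sum>c<k. g $ c * v $ c)"
    using k grad(2) by (intro sum.mono_neutral_right) (auto simp: g_def)
  finally have "\<bar>g \<bullet> v\<bar> \<le> (\<Sum>c<k. \<bar>g $ c\<bar> * \<bar>v $ c\<bar>)"
    by (simp add: sum_abs flip: abs_mult)
  also have "\<dots> \<le> (\<Sum>c<k. h * q)"
    using grad(1) q h by (intro sum_mono mult_mono) (auto simp: g_def)
  finally have "\<bar>g \<bullet> v\<bar> \<le> (k * h) * q" by simp
  then have "q \<le> 2 * (k * h) / \<kappa>\<^sup>2 + sqrt (3 * \<epsilon>) * reg_cost A b y / \<kappa>"
    unfolding g_def v_def using h \<kappa>q[unfolded v_def]
    by (intro reg_approx_near[OF A b y z \<epsilon> \<kappa>(1)]) auto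
  then show ?thesis using q[OF j] y j k by (simp add: v_def)
qed

section \<open>The smallest singular value\<close>

lemma symmetric_mat_eigenvalue_ex:
  fixes M :: rmat
  assumes M: "M \<in> carrier_mat k k" and k: "0 < k" and sym: "transpose_mat M = M"
  shows "\<exists>e. eigenvalue M e"
proof -
  define C where "C = map_mat complex_of_real M"
  have C: "C \<in> carrier_mat k k" and C_sym: "transpose_mat C = C"
    using M sym by (simp_all add: C_def map_mat_transpose)
  obtain \<mu> where "eigenvalue C \<mu>"
    using spectrum_non_empty[OF C k] by (auto simp: spectrum_def)
  then obtain v where v: "v \<in> carrier_vec k" "v \<noteq> 0\<^sub>v k" "C *\<^sub>v v = \<mu> \<cdot>\<^sub>v v"
    using C by (auto simp: eigenvalue_def eigenvector_def)
  have "C *\<^sub>v conjugate v = conjugate (C *\<^sub>v v)"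
    using M v(1) by (intro eq_vecI) (auto simp: C_def scalar_prod_def)
  then have conj: "C *\<^sub>v conjugate v = conjugate \<mu> \<cdot>\<^sub>v conjugate v"
    using v(3) by (simp add: conjugate_smult_vec)
  have "cnj \<mu> * (conjugate v \<bullet> v) = (transpose_mat C *\<^sub>v conjugate v) \<bullet> v"
    using v(1) by (simp add: C_sym conj)
  also have "\<dots> = conjugate v \<bullet> (C *\<^sub>v v)"
    using C v(1) by (intro transpose_vec_mult_scalar) auto
  also have "\<dots> = \<mu> * (conjugate v \<bullet> v)" using v by simp
  finally have "cnj \<mu> = \<mu>"
    using v(1,2) conjugate_square_eq_0_vec[OF v(1)] comm_scalar_prod[of v k "conjugate v"] by simp
  then obtain e where e: "\<mu> = complex_of_real e"
    by (metis Reals_cnj_iff Reals_cases)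
  have "poly (char_poly C) \<mu> = 0" using \<open>eigenvalue C \<mu>\<close> eigenvalue_root_char_poly[OF C] by simp
  moreover have "char_poly C = map_poly complex_of_real (char_poly M)"
    unfolding C_def by (rule of_real_hom.char_poly_hom[OF M])
  ultimately have "poly (char_poly M) e = 0" by (simp add: e)
  then show ?thesis using eigenvalue_root_char_poly[OF M] by auto
qed

lemma gram_eigenvalue_ge:
  fixes M :: rmat
  assumes M: "M \<in> carrier_mat p k" and e: "eigenvalue (transpose_mat M * M) e"
    and ge: "\<And>v. v \<in> carrier_vec k \<Longrightarrow> \<sigma> * eucl_norm v \<le> eucl_norm (M *\<^sub>v v)"
  shows "\<sigma> \<le> sqrt e"
proof -
  obtain v where v: "v \<in> carrier_vec k" "v \<noteq> 0\<^sub>v k" "(transpose_mat M * M) *\<^sub>v v = e \<cdot>\<^sub>v v"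
    using e M by (auto simp: eigenvalue_def eigenvector_def)
  have "(M *\<^sub>v v) \<bullet> (M *\<^sub>v v) = (transpose_mat M *\<^sub>v (M *\<^sub>v v)) \<bullet> v"
    using M v by (intro transpose_vec_mult_scalar[symmetric]) auto
  also have "transpose_mat M *\<^sub>v (M *\<^sub>v v) = e \<cdot>\<^sub>v v"
    using M v by (simp flip: v(3))
  finally have "eucl_norm (M *\<^sub>v v) = sqrt e * eucl_norm v"
    using v(1) by (simp add: eucl_norm_def real_sqrt_mult)
  with ge[OF v(1)] have "\<sigma> * eucl_norm v \<le> sqrt e * eucl_norm v" by simp
  moreover have "0 < eucl_norm v"
    using v eucl_norm_nonneg[of v] by (simp add: eucl_norm_eq_0_iff order_less_le)
  ultimately show ?thesis by simp
qed

lemma smallest_singular_value_ge: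
  fixes A :: rmat
  assumes A: "A \<in> carrier_mat n d" and d: "0 < d" "d \<le> n"
    and ge: "\<And>v. v \<in> carrier_vec d \<Longrightarrow> \<sigma> * eucl_norm v \<le> eucl_norm (A *\<^sub>v v)"
  shows "\<sigma> \<le> smallest_singular_value A"
proof -
  define G where "G = transpose_mat A * A"
  have G: "G \<in> carrier_mat d d" and sym: "transpose_mat G = G"
    using A by (simp_all add: G_def transpose_mult[OF _ A])
  have sv: "singular_values A = sqrt ` spectrum G"
    using A d by (auto simp: singular_values_def G_def spectrum_def)
  have "spectrum G \<noteq> {}"
    using symmetric_mat_eigenvalue_ex[OF G d(1) sym] by (auto simp: spectrum_def)
  moreover have "finite (spectrum G)" using card_finite_spectrum[OF G] by simp
  moreover have "\<sigma> \<le> sqrt e" if "e \<in> spectrum G" for e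
    using that gram_eigenvalue_ge[OF A _ ge] by (auto simp: spectrum_def G_def)
  ultimately show ?thesis
    unfolding smallest_singular_value_def sv by (subst Min_ge_iff) auto
qed

lemma smallest_singular_value_transpose:
  assumes "dim_row A < dim_col A"
  shows "smallest_singular_value (transpose_mat A) = smallest_singular_value A"
  using assms by (simp add: smallest_singular_value_def singular_values_def)

lemma smallest_singular_value_ge_dominant:
  fixes M :: rmat
  assumes M: "M \<in> carrier_mat p k" and k: "0 < k" "k \<le> p"
    and \<rho>: "\<And>c. c < k \<Longrightarrow> \<rho> c < p"
    and dominant: "\<And>c. c < k \<Longrightarrow> \<kappa> + (\<Sum>c'\<in>{..<k} - {c}. \<bar>M $$ (\<rho> c, c')\<bar>) \<le> \<bar>M $$ (\<rho> c, c)\<bar>"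
    and \<kappa>: "0 \<le> \<kappa>"
  shows "\<kappa> / sqrt k \<le> smallest_singular_value M"
proof (rule smallest_singular_value_ge[OF M k])
  fix v :: rvec
  assume v: "v \<in> carrier_vec k"
  have "eucl_norm (\<kappa> \<cdot>\<^sub>v v) \<le> sqrt k * eucl_norm (M *\<^sub>v v)"
    using v row_dominant_mult_vec_ge[OF M v _ \<rho> dominant \<kappa>] \<kappa>
    by (intro eucl_norm_le) (auto simp: abs_mult eucl_norm_nonneg)
  moreover have "eucl_norm (\<kappa> \<cdot>\<^sub>v v) = \<kappa> * eucl_norm v"
    using v \<kappa> by (simp add: eucl_norm_def real_sqrt_mult)
  ultimately show "\<kappa> / sqrt k * eucl_norm v \<le> eucl_norm (M *\<^sub>v v)"
    using k by (simp add: field_simps)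
qed

section \<open>Anchored matrices\<close>

lemma abs_index_mult_mat_vec_le:
  fixes M :: rmat
  assumes M: "M \<in> carrier_mat p k" and v: "v \<in> carrier_vec k" and r: "r < p"
    and C: "\<And>r c. r < p \<Longrightarrow> c < k \<Longrightarrow> \<bar>M $$ (r, c)\<bar> \<le> C" and V: "\<And>c. c < k \<Longrightarrow> \<bar>v $ c\<bar> \<le> V"
  shows "\<bar>(M *\<^sub>v v) $ r\<bar> \<le> k * (C * V)"
proof -
  have "(M *\<^sub>v v) $ r = (\<Sum>c<k. M $$ (r, c) * v $ c)"
    using M v r by (auto simp: scalar_prod_def lessThan_atLeast0 intro!: sum.cong)
  then have "\<bar>(M *\<^sub>v v) $ r\<bar> \<le> (\<Sum>c<k. \<bar>M $$ (r, c)\<bar> * \<bar>v $ c\<bar>)"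
    by (simp add: sum_abs flip: abs_mult)
  also have "\<dots> \<le> (\<Sum>c<k. C * V)"
    using C[OF r] V by (intro sum_mono mult_mono) (auto intro: order_trans[OF abs_ge_zero])
  finally show ?thesis by simp
qed

lemma transpose_mat_smult: "transpose_mat (a \<cdot>\<^sub>m M) = a \<cdot>\<^sub>m transpose_mat M"
  by (rule eq_matI) auto

definition anchor_mat :: "nat \<Rightarrow> nat \<Rightarrow> (nat \<Rightarrow> nat) \<Rightarrow> nat \<Rightarrow> rmat" where
  "anchor_mat n d \<rho> k = Matrix.mat n d (\<lambda>(r, c). if c < k \<and> r = \<rho> c then 1 else 0)"

lemma anchor_mat_carrier [simp]: "anchor_mat n d \<rho> k \<in> carrier_mat n d"
  by (simp add: anchor_mat_def)

lemma dim_anchor_mat [simp]: "dim_row (anchor_mat n d \<rho> k) = n" "dim_col (anchor_mat n d \<rho> k) = d"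
  by (simp_all add: anchor_mat_def)

lemma index_anchor_mat [simp]:
  "r < n \<Longrightarrow> c < d \<Longrightarrow> anchor_mat n d \<rho> k $$ (r, c) = (if c < k \<and> r = \<rho> c then 1 else 0)"
  by (simp add: anchor_mat_def)

lemma transpose_anchor_mat:
  assumes \<rho>: "\<rho> permutes {..<n}" and n: "n \<le> d"
  shows "transpose_mat (anchor_mat n d \<rho> n) = anchor_mat d n (inv_into UNIV \<rho>) n"
    (is "?T = anchor_mat d n ?\<pi> n")
proof (rule eq_matI)
  fix c r
  assume "c < dim_row (anchor_mat d n ?\<pi> n)" "r < dim_col (anchor_mat d n ?\<pi> n)"
  then have c: "c < d" and r: "r < n" by auto
  have "c < n \<and> r = \<rho> c \<longleftrightarrow> c = ?\<pi> r"
    using r permutes_in_image[OF permutes_inv[OF \<rho>], of r] permutes_inverses[OF \<rho>] by auto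
  then show "?T $$ (c, r) = anchor_mat d n ?\<pi> n $$ (c, r)" using c r by simp
qed auto

locale anchored_matrix =
  fixes n d k :: nat and \<rho> :: "nat \<Rightarrow> nat" and A B :: rmat and N :: real
  assumes B: "B \<in> carrier_mat n d"
    and k_le: "k \<le> d"
    and inj: "inj_on \<rho> {..<k}"
    and \<rho>_less: "\<And>c. c < k \<Longrightarrow> \<rho> c < n"
    and A_eq: "A = B + N \<cdot>\<^sub>m anchor_mat n d \<rho> k"
begin

lemma A_carrier: "A \<in> carrier_mat n d"
  using B by (simp add: A_eq)

lemma k_le_n: "k \<le> n"
  using card_inj_on_le[OF inj, of "{..<n}"] \<rho>_less by auto

lemma mult_vec_anchored:
  assumes v: "v \<in> carrier_vec d" and c: "c < k"
  shows "(A *\<^sub>v v) $ \<rho> c = (B *\<^sub>v v) $ \<rho> c + N * v $ c"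
proof -
  have "row (N \<cdot>\<^sub>m anchor_mat n d \<rho> k) (\<rho> c) \<bullet> v = (\<Sum>c'<d. if c' = c then N * v $ c else 0)"
    unfolding scalar_prod_def lessThan_atLeast0
    using v c k_le \<rho>_less[OF c] inj_onD[OF inj] by (intro sum.cong) auto
  also have "\<dots> = N * v $ c" using c k_le by simp
  finally show ?thesis
    using B v \<rho>_less[OF c] by (simp add: A_eq add_mult_distrib_mat_vec[where nr = n and nc = d])
qed

lemma mult_vec_unanchored:
  assumes v: "v \<in> carrier_vec d" and r: "r < n" "r \<notin> \<rho> ` {..<k}"
  shows "(A *\<^sub>v v) $ r = (B *\<^sub>v v) $ r"
proof -
  have "row (N \<cdot>\<^sub>m anchor_mat n d \<rho> k) r \<bullet> v = 0"
    unfolding scalar_prod_def using v r by (intro sum.neutral) auto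
  then show ?thesis
    using B v r by (simp add: A_eq add_mult_distrib_mat_vec[where nr = n and nc = d])
qed

lemma transpose_mult_vec:
  assumes w: "w \<in> carrier_vec n" and c: "c < d"
  shows "(transpose_mat A *\<^sub>v w) $ c
    = (transpose_mat B *\<^sub>v w) $ c + (if c < k then N * w $ \<rho> c else 0)"
proof -
  have "col (N \<cdot>\<^sub>m anchor_mat n d \<rho> k) c \<bullet> w
      = (\<Sum>r<n. if r = \<rho> c then (if c < k then N * w $ \<rho> c else 0) else 0)"
    unfolding scalar_prod_def lessThan_atLeast0 using w c by (intro sum.cong) auto
  also have "\<dots> = (if c < k then N * w $ \<rho> c else 0)" using \<rho>_less by auto
  finally show ?thesis
    using B w c by (simp add: A_eq transpose_add[where nr = n and nc = d]
        add_mult_distrib_mat_vec[where nr = d and nc = n])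
qed

lemma row_dominant:
  assumes C: "\<And>r c. r < n \<Longrightarrow> c < d \<Longrightarrow> \<bar>B $$ (r, c)\<bar> \<le> C" and c: "c < k"
  shows "N - C * k + (\<Sum>c'\<in>{..<k} - {c}. \<bar>A $$ (\<rho> c, c')\<bar>) \<le> \<bar>A $$ (\<rho> c, c)\<bar>"
proof -
  have "\<bar>A $$ (\<rho> c, c')\<bar> \<le> C" if "c' < k" "c' \<noteq> c" for c'
    using that c k_le B C[of "\<rho> c" c'] \<rho>_less[OF c] inj_onD[OF inj, of c c'] by (auto simp: A_eq)
  then have "(\<Sum>c'\<in>{..<k} - {c}. \<bar>A $$ (\<rho> c, c')\<bar>) \<le> (\<Sum>c'\<in>{..<k} - {c}. C)"
    by (intro sum_mono) auto
  also have "\<dots> = C * k - C" using c by (simp add: of_nat_diff algebra_simps)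
  finally show ?thesis
    using c k_le B C[of "\<rho> c" c] \<rho>_less[OF c] by (simp add: A_eq)
qed

lemma smallest_singular_value_anchored_ge:
  assumes C: "\<And>r c. r < n \<Longrightarrow> c < d \<Longrightarrow> \<bar>B $$ (r, c)\<bar> \<le> C" and k: "k = d" "0 < d" and N: "C * d \<le> N"
  shows "(N - C * d) / sqrt d \<le> smallest_singular_value A"
  using A_carrier k k_le_n \<rho>_less row_dominant[OF C] N
  by (intro smallest_singular_value_ge_dominant[where p = n and \<rho> = \<rho>]) auto

end

lemma smallest_singular_value_anchored_permutes_ge:
  assumes B: "B \<in> carrier_mat n d" and C: "\<And>r c. r < n \<Longrightarrow> c < d \<Longrightarrow> \<bar>B $$ (r, c)\<bar> \<le> C"
    and \<rho>: "\<rho> permutes {..<n}" and n: "0 < n" and d: "0 < d" and N: "C * real (min n d) \<le> N"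
  shows "(N - C * real (min n d)) / sqrt (real (min n d))
    \<le> smallest_singular_value (B + N \<cdot>\<^sub>m anchor_mat n d \<rho> (min n d))"
    (is "_ \<le> smallest_singular_value ?A")
proof (cases "d \<le> n")
  case True
  interpret anchored_matrix n d d \<rho> ?A B N
    using True B permutes_inj_on[OF \<rho>] permutes_in_image[OF \<rho>]
    by unfold_locales (auto simp: min_absorb2)
  show ?thesis using smallest_singular_value_anchored_ge[OF C] True d N by (simp add: min_absorb2)
next
  case False
  let ?\<pi> = "inv_into UNIV \<rho>"
  interpret anchored_matrix d n n ?\<pi> "transpose_mat ?A" "transpose_mat B" N
  proof
    show "transpose_mat ?A = transpose_mat B + N \<cdot>\<^sub>m anchor_mat d n ?\<pi> n"
      using False B transpose_anchor_mat[OF \<rho>, of d]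
      by (simp add: transpose_add[where nr = n and nc = d] transpose_mat_smult)
    show "?\<pi> r < d" if "r < n" for r
      using that False permutes_in_image[OF permutes_inv[OF \<rho>], of r] by simp
  qed (use False B permutes_inj_on[OF permutes_inv[OF \<rho>]] in auto)
  have "(N - C * n) / sqrt n \<le> smallest_singular_value (transpose_mat ?A)"
    using B carrier_matD[OF B] C n N False by (intro smallest_singular_value_anchored_ge) auto
  also have "\<dots> = smallest_singular_value ?A"
    using False B by (intro smallest_singular_value_transpose) auto
  finally show ?thesis using False by simp
qed

lemma filterlim_smallest_singular_value_anchored:
  assumes A: "\<And>t. A t = B t + N t \<cdot>\<^sub>m anchor_mat n d \<rho> (min n d)"
    and B: "\<And>t. B t \<in> carrier_mat n d"
    and C: "\<And>t r c. r < n \<Longrightarrow> c < d \<Longrightarrow> \<bar>B t $$ (r, c)\<bar> \<le> C"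
    and \<rho>: "\<rho> permutes {..<n}" and n: "0 < n" and d: "0 < d"
    and N: "filterlim N at_top F"
  shows "filterlim (\<lambda>t. smallest_singular_value (A t)) at_top F"
proof -
  define m where "m = min n d"
  have m: "0 < m" using n d by (simp add: m_def)
  have "filterlim (\<lambda>t. 1 / sqrt m * (- (C * m) + N t)) at_top F"
    using m by (intro filterlim_tendsto_pos_mult_at_top[OF tendsto_const]
        filterlim_tendsto_add_at_top[OF tendsto_const N]) auto
  then have "filterlim (\<lambda>t. (N t - C * m) / sqrt m) at_top F" by (simp add: field_simps)
  moreover have "\<forall>\<^sub>F t in F. C * m \<le> N t" using N by (auto simp: filterlim_at_top)
  then have "\<forall>\<^sub>F t in F. (N t - C * m) / sqrt m \<le> smallest_singular_value (A t)"
  proof eventually_elim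
    case (elim t)
    then show ?case
      unfolding A m_def by (intro smallest_singular_value_anchored_permutes_ge B C \<rho> n d)
  qed
  ultimately show ?thesis by (rule filterlim_at_top_mono)
qed

section \<open>Querying an unanchored row\<close>

locale anchored_block = anchored_matrix +
  assumes abs_B_le: "\<And>r c. r < n \<Longrightarrow> c < d \<Longrightarrow> \<bar>B $$ (r, c)\<bar> \<le> 1"
    and B_anchored_row: "\<And>c c'. c < k \<Longrightarrow> c' < d \<Longrightarrow> B $$ (\<rho> c, c') = 0"
    and B_free_column: "\<And>r c. r < n \<Longrightarrow> k \<le> c \<Longrightarrow> c < d \<Longrightarrow> B $$ (r, c) = 0"
    and N_pos: "0 < N"
    and N_large: "8 * (real n * (real d)\<^sup>2) \<le> N\<^sup>2"
begin

text \<open>For an unanchored row \<open>i\<close>, the normal equations \<open>A\<^sup>T A y = A\<^sup>T e\<^sub>i\<close> are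
  \<open>N\<^sup>2 y + B\<^sup>T B y = B\<^sup>T e\<^sub>i\<close>.\<close>

definition approx_solution :: "nat \<Rightarrow> rvec" where
  "approx_solution i = (1 / N\<^sup>2) \<cdot>\<^sub>v row B i"

definition residual :: "nat \<Rightarrow> rvec" where
  "residual i = A *\<^sub>v approx_solution i - unit_vec n i"

lemma approx_solution_carrier: "approx_solution i \<in> carrier_vec d"
  using row_carrier[of B i] carrier_matD(2)[OF B] by (simp add: approx_solution_def)

lemma index_approx_solution: "i < n \<Longrightarrow> c < d \<Longrightarrow> approx_solution i $ c = B $$ (i, c) / N\<^sup>2"
  using B by (simp add: approx_solution_def)

lemma residual_carrier: "residual i \<in> carrier_vec n"
  using mult_mat_vec_carrier[OF A_carrier approx_solution_carrier] by (simp add: residual_def)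

lemma B_mult_vec_anchored: "v \<in> carrier_vec d \<Longrightarrow> c < k \<Longrightarrow> (B *\<^sub>v v) $ \<rho> c = 0"
  using B B_anchored_row \<rho>_less by (auto simp: scalar_prod_def intro!: sum.neutral)

lemma abs_B_mult_approx_solution_le:
  assumes "i < n" "m < n"
  shows "\<bar>(B *\<^sub>v approx_solution i) $ m\<bar> \<le> d / N\<^sup>2"
  using abs_index_mult_mat_vec_le[OF B approx_solution_carrier assms(2) abs_B_le, of i "1 / N\<^sup>2"]
    abs_B_le assms(1)
  by (simp add: index_approx_solution divide_right_mono)

lemma residual_anchored:
  assumes i: "i < n" "i \<notin> \<rho> ` {..<k}" and c: "c < k"
  shows "residual i $ \<rho> c = B $$ (i, c) / N"
proof -
  have "\<rho> c \<noteq> i" using i(2) c by auto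
  then show ?thesis
    using mult_vec_anchored[OF approx_solution_carrier c]
      B_mult_vec_anchored[OF approx_solution_carrier c] \<rho>_less[OF c] i(1) c k_le N_pos
    by (simp add: residual_def index_approx_solution unit_vec_def power2_eq_square)
qed

lemma residual_unanchored:
  assumes "m < n" "m \<notin> \<rho> ` {..<k}"
  shows "residual i $ m = (B *\<^sub>v approx_solution i - unit_vec n i) $ m"
  using mult_vec_unanchored[OF approx_solution_carrier assms] assms by (simp add: residual_def)

lemma d_le_N_power2:
  assumes "0 < n"
  shows "d \<le> N\<^sup>2"
proof -
  have "real d \<le> (real d)\<^sup>2" by (cases d) (simp_all add: power2_eq_square)
  also have "\<dots> \<le> real n * (real d)\<^sup>2" using assms by (simp add: mult_le_cancel_right1)
  finally show ?thesis using N_large of_nat_0_le_iff[of d] by linarith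
qed

lemma N_ge_1:
  assumes "0 < n" "0 < d"
  shows "1 \<le> N"
proof -
  have "1\<^sup>2 \<le> N\<^sup>2" using d_le_N_power2[OF assms(1)] assms(2) by simp
  then show ?thesis using N_pos by (intro power2_le_imp_le[of 1]) auto
qed

lemma abs_residual_le:
  assumes i: "i < n" "i \<notin> \<rho> ` {..<k}" and m: "m < n"
  shows "\<bar>residual i $ m\<bar> \<le> 2"
proof (cases "m \<in> \<rho> ` {..<k}")
  case True
  then obtain c where c: "m = \<rho> c" "c < k" by auto
  have "\<bar>B $$ (i, c)\<bar> \<le> 1" using abs_B_le i(1) c(2) k_le by simp
  moreover have "1 \<le> N" using N_ge_1 i(1) c(2) k_le by simp
  ultimately have "\<bar>B $$ (i, c) / N\<bar> \<le> 1" by (simp add: divide_le_eq)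
  then show ?thesis unfolding c(1) residual_anchored[OF i c(2)] by linarith
next
  case False
  have "d / N\<^sup>2 \<le> 1" using d_le_N_power2 i(1) N_pos by (simp add: divide_le_eq)
  then have "\<bar>(B *\<^sub>v approx_solution i) $ m\<bar> \<le> 1"
    using abs_B_mult_approx_solution_le[OF i(1) m] by linarith
  then show ?thesis
    using residual_unanchored[OF m False] m B i(1) by (auto simp: unit_vec_def)
qed

lemma reg_cost_approx_solution_le:
  assumes "i < n" "i \<notin> \<rho> ` {..<k}"
  shows "reg_cost A (unit_vec n i) (approx_solution i) \<le> sqrt n * 2"
  unfolding reg_cost_def residual_def[symmetric]
  by (intro eucl_norm_le[OF residual_carrier] abs_residual_le[OF assms]) auto

lemma transpose_B_mult_residual:
  assumes i: "i < n" and c: "c < d"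
  shows "(transpose_mat B *\<^sub>v residual i) $ c
    = (transpose_mat B *\<^sub>v (B *\<^sub>v approx_solution i)) $ c - B $$ (i, c)"
proof -
  define w where "w = B *\<^sub>v approx_solution i"
  have w: "w \<in> carrier_vec n" using B approx_solution_carrier by (simp add: w_def)
  have "B $$ (m, c) * residual i $ m = B $$ (m, c) * (w - unit_vec n i) $ m" if "m < n" for m
    using residual_unanchored[OF that] B_anchored_row[OF _ c]
    by (cases "m \<in> \<rho> ` {..<k}") (auto simp: w_def)
  then have "(transpose_mat B *\<^sub>v residual i) $ c = (transpose_mat B *\<^sub>v (w - unit_vec n i)) $ c"
    using B residual_carrier[of i] w c by (auto simp: scalar_prod_def intro!: sum.cong)
  also have "\<dots> = (transpose_mat B *\<^sub>v w) $ c - B $$ (i, c)"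
    using B w c i mult_minus_distrib_mat_vec[of "transpose_mat B" d n w "unit_vec n i"] by simp
  finally show ?thesis by (simp add: w_def)
qed

lemma abs_gradient_anchored_le:
  assumes i: "i < n" "i \<notin> \<rho> ` {..<k}" and c: "c < k"
  shows "\<bar>(transpose_mat A *\<^sub>v residual i) $ c\<bar> \<le> n * (d / N\<^sup>2)"
proof -
  define w where "w = B *\<^sub>v approx_solution i"
  have w: "w \<in> carrier_vec n" using B approx_solution_carrier by (simp add: w_def)
  have "(transpose_mat A *\<^sub>v residual i) $ c = (transpose_mat B *\<^sub>v w) $ c"
    using transpose_mult_vec[OF residual_carrier, of c i] transpose_B_mult_residual[OF i(1), of c]
      residual_anchored[OF i c] c k_le N_pos by (simp add: w_def)
  then show ?thesis
    using B w c k_le abs_B_le abs_B_mult_approx_solution_le[OF i(1)]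
      abs_index_mult_mat_vec_le[of "transpose_mat B" d n w c 1 "d / N\<^sup>2"]
    by (simp add: w_def)
qed

lemma gradient_free:
  assumes c: "k \<le> c" "c < d"
  shows "(transpose_mat A *\<^sub>v residual i) $ c = 0"
proof -
  have "(transpose_mat B *\<^sub>v residual i) $ c = 0"
    using B residual_carrier[of i] c B_free_column
    by (auto simp: scalar_prod_def intro!: sum.neutral)
  then show ?thesis using transpose_mult_vec[OF residual_carrier c(2)] c(1) by simp
qed

lemma mult_vec_ge:
  assumes v: "v \<in> carrier_vec d" and c: "c < k"
  shows "N * \<bar>v $ c\<bar> \<le> eucl_norm (A *\<^sub>v v)"
proof -
  have "N * \<bar>v $ c\<bar> = \<bar>(A *\<^sub>v v) $ \<rho> c\<bar>"
    using mult_vec_anchored[OF v c] B_mult_vec_anchored[OF v c] N_pos by (simp add: abs_mult)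
  also have "\<dots> \<le> eucl_norm (A *\<^sub>v v)"
    using mult_mat_vec_carrier[OF A_carrier v] \<rho>_less[OF c] by (rule abs_index_le_eucl_norm)
  finally show ?thesis .
qed

lemma gradient_error_le: "2 * (k * (n * (d / N\<^sup>2))) / N\<^sup>2 \<le> 1 / 4 / N\<^sup>2"
proof (rule divide_right_mono)
  have "real k * (real n * d) \<le> d * (real n * d)"
    using k_le by (intro mult_right_mono) auto
  then have "8 * (real k * n * d) \<le> 8 * (real n * (real d)\<^sup>2)"
    by (simp add: power2_eq_square mult_ac)
  then show "2 * (k * (n * (d / N\<^sup>2))) \<le> 1 / 4"
    using N_large N_pos by (simp add: divide_le_eq mult_ac)
qed simp

lemma approximation_error_le:
  fixes \<epsilon> :: real
  assumes i: "i < n" "i \<notin> \<rho> ` {..<k}" and \<epsilon>: "0 \<le> \<epsilon>" "48 * real n * N\<^sup>2 * \<epsilon> \<le> 1"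
  shows "sqrt (3 * \<epsilon>) * reg_cost A (unit_vec n i) (approx_solution i) / N \<le> 1 / 2 / N\<^sup>2"
proof -
  have "sqrt (3 * \<epsilon>) * reg_cost A (unit_vec n i) (approx_solution i) / N
      \<le> sqrt (3 * \<epsilon>) * (sqrt n * 2) / N"
    using reg_cost_approx_solution_le[OF i] \<epsilon>(1) N_pos
    by (intro divide_right_mono mult_left_mono) auto
  also have "\<dots> = sqrt ((4 * N)\<^sup>2 * n * (3 * \<epsilon>)) / 2 / N\<^sup>2"
    using N_pos unfolding real_sqrt_mult real_sqrt_abs by (simp add: power2_eq_square)
  also have "\<dots> \<le> 1 / 2 / N\<^sup>2"
    using \<epsilon>(2) by (intro divide_right_mono) (simp_all add: power_mult_distrib mult_ac)
  finally show ?thesis .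
qed

lemma reg_approx_unit_query:
  fixes \<epsilon> :: real
  assumes i: "i < n" "i \<notin> \<rho> ` {..<k}" and j: "j < k"
    and z: "z \<in> reg_approx \<epsilon> A (unit_vec n i)" and \<epsilon>: "0 \<le> \<epsilon>" "48 * real n * N\<^sup>2 * \<epsilon> \<le> 1"
  shows "\<bar>z $ j - B $$ (i, j) / N\<^sup>2\<bar> < 1 / N\<^sup>2"
proof -
  let ?y = "approx_solution i"
  have "1 \<le> real n" "1 \<le> N\<^sup>2"
    using i N_ge_1 j k_le by (auto intro: one_le_power)
  then have "1 * \<epsilon> \<le> 48 * (n * N\<^sup>2) * \<epsilon>"
    using mult_mono[of 1 "real n" 1 "N\<^sup>2"] \<epsilon>(1) by (intro mult_right_mono) auto
  then have "\<epsilon> \<le> 1" using \<epsilon>(2) by (simp add: mult.assoc)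
  then have "\<bar>z $ j - ?y $ j\<bar>
      \<le> 2 * (k * (n * (d / N\<^sup>2))) / N\<^sup>2 + sqrt (3 * \<epsilon>) * reg_cost A (unit_vec n i) ?y / N"
    using abs_gradient_anchored_le[OF i] gradient_free mult_vec_ge z \<epsilon>(1) k_le j N_pos
    by (intro reg_approx_index_near[OF A_carrier _ approx_solution_carrier])
       (auto simp flip: residual_def)
  also have "\<dots> \<le> 1 / 4 / N\<^sup>2 + 1 / 2 / N\<^sup>2"
    by (intro add_mono gradient_error_le approximation_error_le[OF i \<epsilon>])
  also have "\<dots> = 3 / 4 / N\<^sup>2" by simp
  also have "\<dots> < 1 / N\<^sup>2" using N_pos by (intro divide_strict_right_mono) auto
  finally show ?thesis using j k_le i(1) by (simp add: index_approx_solution)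
qed

end

section \<open>Querying an anchored row\<close>

locale anchored_columns = anchored_matrix n d d \<rho> A B N
  for n d :: nat and \<rho> :: "nat \<Rightarrow> nat" and A B :: rmat and N :: real +
  assumes abs_B_le: "\<And>r c. r < n \<Longrightarrow> c < d \<Longrightarrow> \<bar>B $$ (r, c)\<bar> \<le> 1"
    and N_ge: "2 * d \<le> N" "0 < N"
begin

text \<open>With \<open>b = N e\<^sub>i\<close> for the row \<open>i = \<rho> j\<close>, the vector \<open>e\<^sub>j\<close> leaves the residual \<open>B e\<^sub>j\<close>. Its
  anchored entries are removed by a correction of order \<open>1 / N\<close>.\<close>

definition correction :: "nat \<Rightarrow> rvec" where
  "correction j = Matrix.vec d (\<lambda>c. B $$ (\<rho> c, j))"

definition approx_solution :: "nat \<Rightarrow> rvec" where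
  "approx_solution j = unit_vec d j - (1 / N) \<cdot>\<^sub>v correction j"

definition residual :: "nat \<Rightarrow> rvec" where
  "residual j = A *\<^sub>v approx_solution j - N \<cdot>\<^sub>v unit_vec n (\<rho> j)"

lemma correction_carrier: "correction j \<in> carrier_vec d"
  by (simp add: correction_def)

lemma approx_solution_carrier: "approx_solution j \<in> carrier_vec d"
  by (simp add: approx_solution_def correction_carrier)

lemma index_approx_solution:
  "c < d \<Longrightarrow> approx_solution j $ c = (if c = j then 1 else 0) - B $$ (\<rho> c, j) / N"
  by (simp add: approx_solution_def correction_def unit_vec_def)

lemma residual_carrier: "residual j \<in> carrier_vec n"
  using mult_mat_vec_carrier[OF A_carrier approx_solution_carrier] by (simp add: residual_def)

lemma abs_B_mult_correction_le: "j < d \<Longrightarrow> m < n \<Longrightarrow> \<bar>(B *\<^sub>v correction j) $ m\<bar> \<le> d"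
  using abs_index_mult_mat_vec_le[OF B correction_carrier _ abs_B_le, of m j 1] abs_B_le \<rho>_less
  by (simp add: correction_def)

lemma B_mult_approx_solution:
  assumes "j < d" "m < n"
  shows "(B *\<^sub>v approx_solution j) $ m = B $$ (m, j) - (B *\<^sub>v correction j) $ m / N"
  using B assms correction_carrier[of j]
    mult_minus_distrib_mat_vec[OF B, of "unit_vec d j" "(1 / N) \<cdot>\<^sub>v correction j"]
  by (simp add: approx_solution_def)

lemma residual_anchored:
  assumes j: "j < d" and c: "c < d"
  shows "residual j $ \<rho> c = - ((B *\<^sub>v correction j) $ \<rho> c / N)"
proof -
  have "\<rho> c = \<rho> j \<longleftrightarrow> c = j" using inj_onD[OF inj] c j by auto
  then show ?thesis
    using mult_vec_anchored[OF approx_solution_carrier c] B_mult_approx_solution[OF j \<rho>_less[OF c]]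
      \<rho>_less[OF c] \<rho>_less[OF j] c N_ge
    by (auto simp: residual_def index_approx_solution unit_vec_def right_diff_distrib)
qed

lemma residual_unanchored:
  assumes j: "j < d" and m: "m < n" "m \<notin> \<rho> ` {..<d}"
  shows "residual j $ m = B $$ (m, j) - (B *\<^sub>v correction j) $ m / N"
  using mult_vec_unanchored[OF approx_solution_carrier m] B_mult_approx_solution[OF j m(1)] m j
  by (auto simp: residual_def unit_vec_def)

lemma abs_residual_le:
  assumes j: "j < d" and m: "m < n"
  shows "\<bar>residual j $ m\<bar> \<le> 2"
proof -
  have "\<bar>(B *\<^sub>v correction j) $ m / N\<bar> \<le> 1"
    using abs_B_mult_correction_le[OF j m] N_ge by (simp add: divide_le_eq)
  moreover have "residual j $ m = - ((B *\<^sub>v correction j) $ m / N) \<or>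
      residual j $ m = B $$ (m, j) - (B *\<^sub>v correction j) $ m / N"
    using residual_anchored[OF j] residual_unanchored[OF j m] by auto
  ultimately show ?thesis using abs_B_le[OF m j] by linarith
qed

lemma reg_cost_approx_solution_le:
  assumes "j < d"
  shows "reg_cost A (N \<cdot>\<^sub>v unit_vec n (\<rho> j)) (approx_solution j) \<le> sqrt n * 2"
  unfolding reg_cost_def residual_def[symmetric]
  by (intro eucl_norm_le[OF residual_carrier] abs_residual_le[OF assms]) auto

lemma abs_gradient_le:
  assumes j: "j < d" and c: "c < d"
  shows "\<bar>(transpose_mat A *\<^sub>v residual j) $ c\<bar> \<le> 3 * real n"
proof -
  have "\<bar>(transpose_mat B *\<^sub>v residual j) $ c\<bar> \<le> 2 * real n"
    using abs_index_mult_mat_vec_le[of "transpose_mat B" d n "residual j" c 1 2]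
      B residual_carrier c abs_B_le abs_residual_le[OF j] by simp
  moreover have "\<bar>N * residual j $ \<rho> c\<bar> \<le> d"
    using abs_B_mult_correction_le[OF j \<rho>_less[OF c]] residual_anchored[OF j c] N_ge
    by (simp add: abs_mult)
  ultimately show ?thesis using transpose_mult_vec[OF residual_carrier c] k_le_n c by simp
qed

lemma mult_vec_ge:
  assumes v: "v \<in> carrier_vec d" and c: "c < d"
  shows "N / 2 * \<bar>v $ c\<bar> \<le> eucl_norm (A *\<^sub>v v)"
proof (rule row_dominant_mult_vec_ge[OF A_carrier v c \<rho>_less])
  fix c assume "c < d"
  then show "N / 2 + (\<Sum>c'\<in>{..<d} - {c}. \<bar>A $$ (\<rho> c, c')\<bar>) \<le> \<bar>A $$ (\<rho> c, c)\<bar>"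
    using row_dominant[OF abs_B_le, of c] N_ge by simp
qed (use N_ge in auto)

lemma reg_approx_anchored_query:
  fixes \<epsilon> :: real
  assumes j: "j < d" and N: "96 * (real n)\<^sup>2 \<le> N"
    and z: "z \<in> reg_approx \<epsilon> A (N \<cdot>\<^sub>v unit_vec n (\<rho> j))" and \<epsilon>: "0 \<le> \<epsilon>" "192 * real n * \<epsilon> \<le> 1"
  shows "\<bar>z $ j - (1 - B $$ (\<rho> j, j) / N)\<bar> < 1 / N"
proof -
  let ?y = "approx_solution j" and ?b = "N \<cdot>\<^sub>v (unit_vec n (\<rho> j) :: rvec)"
  have nd: "1 \<le> real n" "real d \<le> n" using \<rho>_less[OF j] k_le_n by auto
  have "\<epsilon> \<le> 1"
    using mult_right_mono[of 1 "192 * real n" \<epsilon>] nd(1) \<epsilon> by simp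
  then have "\<bar>z $ j - ?y $ j\<bar>
      \<le> 2 * (d * (3 * real n)) / (N / 2)\<^sup>2 + sqrt (3 * \<epsilon>) * reg_cost A ?b ?y / (N / 2)"
    using abs_gradient_le[OF j] mult_vec_ge z \<epsilon>(1) j N_ge
    by (intro reg_approx_index_near[OF A_carrier _ approx_solution_carrier, where k = d])
       (auto simp flip: residual_def)
  also have "2 * (d * (3 * real n)) / (N / 2)\<^sup>2 \<le> 1 / 4 / N"
  proof -
    have "96 * (d * real n) \<le> N"
      using N mult_right_mono[OF nd(2), of n] by (simp add: power2_eq_square)
    then show ?thesis using N_ge by (simp add: power2_eq_square field_simps)
  qed
  also have "sqrt (3 * \<epsilon>) * reg_cost A ?b ?y / (N / 2) \<le> 1 / 2 / N"
  proof -
    have "sqrt (3 * \<epsilon>) * (sqrt n * 2) = sqrt (8\<^sup>2 * real n * (3 * \<epsilon>)) / 4"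
      unfolding real_sqrt_mult real_sqrt_abs by simp
    also have "\<dots> \<le> 1 / 4" using \<epsilon>(2) by (simp add: mult_ac)
    finally have "sqrt (3 * \<epsilon>) * reg_cost A ?b ?y \<le> 1 / 4"
      using mult_left_mono[OF reg_cost_approx_solution_le[OF j], of "sqrt (3 * \<epsilon>)"] \<epsilon>(1) by simp
    then show ?thesis using N_ge by (simp add: field_simps)
  qed
  finally have "\<bar>z $ j - ?y $ j\<bar> \<le> 3 / 4 / N" by simp
  also have "\<dots> < 1 / N" using N_ge by (intro divide_strict_right_mono) auto
  finally show ?thesis using j by (simp add: index_approx_solution)
qed

end

section \<open>Streams and their inputs\<close>

lemma stream_prefix_conc: "stream_prefix (us \<frown> \<tau>) (length us + t) = us @ stream_prefix \<tau> t"
  unfolding stream_prefix_def subsequence_def[symmetric] by simp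

lemma stream_prefix_iter:
  assumes "vs \<noteq> []"
  shows "stream_prefix (vs\<^sup>\<omega>) (m * length vs + t) = concat (replicate m vs) @ stream_prefix (vs\<^sup>\<omega>) t"
proof (induction m)
  case (Suc m)
  have "stream_prefix (vs\<^sup>\<omega>) (Suc m * length vs + t)
      = stream_prefix (vs \<frown> vs\<^sup>\<omega>) (length vs + (m * length vs + t))"
    using assms by (simp add: add.assoc flip: iter_unroll)
  also have "\<dots> = concat (replicate (Suc m) vs) @ stream_prefix (vs\<^sup>\<omega>) t"
    unfolding stream_prefix_conc Suc.IH by simp
  finally show ?case .
qed simp

lemma stream_prefix_iter_div_mod:
  assumes "vs \<noteq> []"
  shows "stream_prefix (vs\<^sup>\<omega>) t
    = concat (replicate (t div length vs) vs) @ take (t mod length vs) vs"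
proof -
  have "stream_prefix (vs\<^sup>\<omega>) (t mod length vs) = take (t mod length vs) vs"
  proof (rule nth_equalityI)
    fix i assume "i < length (stream_prefix (vs\<^sup>\<omega>) (t mod length vs))"
    then have "i < t mod length vs" by (simp add: stream_prefix_def)
    moreover from this have "i < length vs"
      using assms by (meson length_greater_0_conv less_trans mod_less_divisor)
    ultimately show "stream_prefix (vs\<^sup>\<omega>) (t mod length vs) ! i = take (t mod length vs) vs ! i"
      using assms by (simp add: stream_prefix_def)
  qed (use assms in \<open>simp add: stream_prefix_def less_imp_le\<close>)
  then show ?thesis
    using stream_prefix_iter[OF assms, of "t div length vs" "t mod length vs"] by simp
qed

lemma prefix_in_prefixes_of:
  assumes "us \<frown> \<tau> \<in> S"
  shows "us \<in> prefixes_of S"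
proof -
  have "us = stream_prefix (us \<frown> \<tau>) (length us)"
    using stream_prefix_conc[of us \<tau> 0] by (simp add: stream_prefix_def)
  with assms show ?thesis unfolding prefixes_of_def by blast
qed

lemma append_in_prefixes_ofD:
  assumes "us @ vs \<in> prefixes_of S"
  shows "us \<in> prefixes_of S"
proof -
  obtain \<sigma> t where \<sigma>: "\<sigma> \<in> S" "us @ vs = prefix t \<sigma>"
    using assms by (auto simp: prefixes_of_def stream_prefix_def subsequence_def)
  then have "\<sigma> = us \<frown> (vs \<frown> suffix t \<sigma>)" by (metis conc_conc prefix_suffix)
  with \<sigma>(1) show ?thesis by (metis prefix_in_prefixes_of)
qed

definition admissible_updates :: "real set \<Rightarrow> nat \<Rightarrow> nat \<Rightarrow> entry_update set" where
  "admissible_updates V n d = {u. upd_in_range n d u \<and> upd_value u \<in> V}"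

lemma turnstile_streams_eq: "turnstile_streams V n d = {\<sigma>. range \<sigma> \<subseteq> admissible_updates V n d}"
  by (auto simp: turnstile_streams_def admissible_updates_def)

lemma conc_iter_in_turnstile_streams:
  assumes "set us \<union> set vs \<subseteq> admissible_updates V n d" and "vs \<noteq> []"
  shows "us \<frown> vs\<^sup>\<omega> \<in> turnstile_streams V n d"
  using assms by (force simp: turnstile_streams_eq)

lemma input_A_carrier [simp]: "input_A n d us \<in> carrier_mat n d"
  by (simp add: input_A_def)

lemma dim_input [simp]:
  "dim_row (input_A n d us) = n" "dim_col (input_A n d us) = d" "dim_vec (input_b n us) = n"
  by (simp_all add: input_A_def input_b_def)

lemma input_A_Nil [simp]: "input_A n d [] = 0\<^sub>m n d"
  by (rule eq_matI) (auto simp: input_A_def)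

lemma input_b_Nil [simp]: "input_b n [] = 0\<^sub>v n"
  by (rule eq_vecI) (auto simp: input_b_def)

lemma input_A_append: "input_A n d (us @ vs) = input_A n d us + input_A n d vs"
  by (rule eq_matI) (auto simp: input_A_def)

lemma input_b_append: "input_b n (us @ vs) = input_b n us + input_b n vs"
  by (rule eq_vecI) (auto simp: input_b_def)

lemma input_A_concat_replicate:
  "input_A n d (concat (replicate m us)) = of_nat m \<cdot>\<^sub>m input_A n d us"
proof (induction m)
  case 0
  show ?case by (rule eq_matI) auto
next
  case (Suc m)
  then show ?case by (simp add: input_A_append) (rule eq_matI, auto simp: algebra_simps)
qed

lemma input_b_concat_replicate:
  "input_b n (concat (replicate m us)) = of_nat m \<cdot>\<^sub>v input_b n us"
proof (induction m)
  case 0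
  show ?case by (rule eq_vecI) auto
next
  case (Suc m)
  then show ?case by (simp add: input_b_append) (rule eq_vecI, auto simp: algebra_simps)
qed

lemma input_A_Upd_b [simp]: "input_A n d [Upd_b i v] = 0\<^sub>m n d"
  by (rule eq_matI) (auto simp: input_A_def)

lemma input_b_Upd_b [simp]: "input_b n [Upd_b i v] = v \<cdot>\<^sub>v unit_vec n i"
  by (rule eq_vecI) (auto simp: input_b_def unit_vec_def)

lemma abs_input_A_le:
  assumes "r < n" "c < d"
  shows "\<bar>input_A n d us $$ (r, c)\<bar> \<le> (\<Sum>u\<leftarrow>us. \<bar>upd_value u\<bar>)"
proof -
  have "\<bar>delta_A u r c\<bar> \<le> \<bar>upd_value u\<bar>" for u by (cases u) auto
  then have "(\<Sum>u\<leftarrow>us. \<bar>delta_A u r c\<bar>) \<le> (\<Sum>u\<leftarrow>us. \<bar>upd_value u\<bar>)" by (rule sum_list_mono)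
  with sum_list_abs[of "map (\<lambda>u. delta_A u r c) us"] show ?thesis
    using assms by (simp add: input_A_def comp_def)
qed

definition bit_sign :: "'a set \<Rightarrow> 'a \<Rightarrow> real" where
  "bit_sign x a = (if a \<in> x then 1 else - 1)"

definition sign_updates :: "nat \<Rightarrow> nat \<Rightarrow> (nat \<times> nat) set \<Rightarrow> entry_update list" where
  "sign_updates m k x = map (\<lambda>(i, j). Upd_A i j (bit_sign x (i, j))) (List.product [0..<m] [0..<k])"

definition anchor_updates :: "(nat \<Rightarrow> nat) \<Rightarrow> nat \<Rightarrow> real \<Rightarrow> entry_update list" where
  "anchor_updates \<rho> k a = map (\<lambda>c. Upd_A (\<rho> c) c a) [0..<k]"

lemma index_input_A_sign_updates:
  assumes "r < n" "c < d"
  shows "input_A n d (sign_updates m k x) $$ (r, c)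
    = (if r < m \<and> c < k then bit_sign x (r, c) else 0)"
proof -
  have "input_A n d (sign_updates m k x) $$ (r, c)
      = (\<Sum>p\<in>{..<m} \<times> {..<k}. delta_A (Upd_A (fst p) (snd p) (bit_sign x p)) r c)"
    using assms by (simp add: input_A_def sign_updates_def comp_def sum_list_distinct_conv_sum_set
        distinct_product case_prod_unfold lessThan_atLeast0)
  also have "\<dots> = (\<Sum>p\<in>{..<m} \<times> {..<k}. if p = (r, c) then bit_sign x (r, c) else 0)"
    by (intro sum.cong) auto
  finally show ?thesis by simp
qed

lemma input_b_sign_updates [simp]: "input_b n (sign_updates m k x) = 0\<^sub>v n"
  by (rule eq_vecI) (auto simp: input_b_def sign_updates_def comp_def case_prod_unfold)

lemma input_A_anchor_updates [simp]:
  "input_A n d (anchor_updates \<rho> k a) = a \<cdot>\<^sub>m anchor_mat n d \<rho> k"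
proof (rule eq_matI)
  fix r c
  assume "r < dim_row (a \<cdot>\<^sub>m anchor_mat n d \<rho> k)" "c < dim_col (a \<cdot>\<^sub>m anchor_mat n d \<rho> k)"
  then have rc: "r < n" "c < d" by simp_all
  then have "input_A n d (anchor_updates \<rho> k a) $$ (r, c)
      = (\<Sum>c'<k. delta_A (Upd_A (\<rho> c') c' a) r c)"
    by (simp add: input_A_def anchor_updates_def comp_def interv_sum_list_conv_sum_set_nat
        lessThan_atLeast0)
  also have "\<dots> = (\<Sum>c'<k. if c' = c then (if r = \<rho> c then a else 0) else 0)"
    by (intro sum.cong) auto
  finally show "input_A n d (anchor_updates \<rho> k a) $$ (r, c) = (a \<cdot>\<^sub>m anchor_mat n d \<rho> k) $$ (r, c)"
    using rc by simp
qed simp_all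

lemma input_b_anchor_updates [simp]: "input_b n (anchor_updates \<rho> k a) = 0\<^sub>v n"
  by (rule eq_vecI) (auto simp: input_b_def anchor_updates_def comp_def)

lemma sign_updates_admissible:
  "\<int> \<subseteq> V \<Longrightarrow> m \<le> n \<Longrightarrow> k \<le> d \<Longrightarrow> set (sign_updates m k x) \<subseteq> admissible_updates V n d"
  by (auto simp: sign_updates_def admissible_updates_def bit_sign_def)

lemma anchor_updates_admissible:
  "a \<in> V \<Longrightarrow> (\<And>c. c < k \<Longrightarrow> \<rho> c < n) \<Longrightarrow> k \<le> d \<Longrightarrow>
     set (anchor_updates \<rho> k a) \<subseteq> admissible_updates V n d"
  by (auto simp: anchor_updates_def admissible_updates_def)

lemma sign_updates_in_small_prefixes_of:
  assumes "sign_updates m k x \<in> prefixes_of S" "m \<le> n" "k \<le> d"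
  shows "sign_updates m k x \<in> small_prefixes_of (n * d) S"
  using assms by (auto simp: small_prefixes_of_def sign_updates_def bit_sign_def mult_le_mono)

section \<open>INDEX queries to asymptotically exact algorithms\<close>

definition near_optima :: "real \<Rightarrow> nat \<Rightarrow> nat \<Rightarrow> entry_update list \<Rightarrow> rvec set" where
  "near_optima \<epsilon> n d us = reg_approx \<epsilon> (input_A n d us) (input_b n us)"

lemma asymptotically_exact_prefix:
  assumes "asymptotically_exact \<delta> n d S \<A>" and "us \<in> prefixes_of S"
  shows "\<exists>\<epsilon>. 1 - \<delta> \<le> measure_pmf.prob (answer \<A> us) (near_optima \<epsilon> n d us)"
  using assms unfolding asymptotically_exact_def prefixes_of_def near_optima_def Let_def by blast

lemma asymptotically_exact_eventually:
  assumes exact: "asymptotically_exact \<delta> n d S \<A>" and \<sigma>: "\<sigma> \<in> S" and \<eta>: "0 < \<eta>"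
  shows "\<forall>\<^sub>F t in sequentially. 1 - \<delta> \<le>
    measure_pmf.prob (answer \<A> (stream_prefix \<sigma> t)) (near_optima \<eta> n d (stream_prefix \<sigma> t))"
proof -
  define success where "success \<epsilon> t =
    measure_pmf.prob (answer \<A> (stream_prefix \<sigma> t)) (near_optima \<epsilon> n d (stream_prefix \<sigma> t))" for \<epsilon> t
  obtain \<epsilon> where \<epsilon>: "\<epsilon> \<longlonglongrightarrow> 0" and le_success: "\<And>t. 1 - \<delta> \<le> success (\<epsilon> t) t"
    using exact \<sigma> unfolding asymptotically_exact_def success_def near_optima_def Let_def by blast
  from \<epsilon> \<eta> have "\<forall>\<^sub>F t in sequentially. \<epsilon> t < \<eta>" by (rule order_tendstoD)
  then have "\<forall>\<^sub>F t in sequentially. 1 - \<delta> \<le> success \<eta> t"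
  proof eventually_elim
    case (elim t)
    note le_success[of t]
    also have "success (\<epsilon> t) t \<le> success \<eta> t"
      unfolding success_def near_optima_def
      using elim by (intro measure_pmf.finite_measure_mono reg_approx_mono) auto
    finally show ?case .
  qed
  then show ?thesis by (simp only: success_def)
qed

lemma asymptotically_exact_iter_eventually:
  assumes exact: "asymptotically_exact \<delta> n d S \<A>" and S: "us \<frown> vs\<^sup>\<omega> \<in> S"
    and vs: "vs \<noteq> []" and \<eta>: "0 < \<eta>"
  shows "\<forall>\<^sub>F N in sequentially. 1 - \<delta> \<le> measure_pmf.prob
    (answer \<A> (us @ concat (replicate N vs))) (near_optima \<eta> n d (us @ concat (replicate N vs)))"
proof -
  have prefix: "stream_prefix (us \<frown> vs\<^sup>\<omega>) (length us + N * length vs)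
      = us @ concat (replicate N vs)" for N
    unfolding stream_prefix_conc
    using stream_prefix_iter[OF vs, of N 0] by (simp add: stream_prefix_def)
  have "filterlim (\<lambda>N. length us + N * length vs) at_top sequentially"
    using vs
    by (intro filterlim_at_top_mono[OF filterlim_ident]) (auto simp: Suc_leI trans_le_add2)
  with asymptotically_exact_eventually[OF exact S \<eta>] show ?thesis
    unfolding prefix[symmetric] by (rule eventually_compose_filterlim)
qed

lemma asymptotic_index_memory_ge:
  fixes enc :: "'i set \<Rightarrow> entry_update list" and suf vs :: "'i \<Rightarrow> entry_update list"
    and dec :: "'i \<Rightarrow> rvec set"
  assumes exact: "asymptotically_exact \<delta> n d S \<A>" and \<delta>: "\<delta> \<le> 1 / 2" and I: "finite I"
    and P: "\<And>x. x \<subseteq> I \<Longrightarrow> enc x \<in> P"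
    and vs: "\<And>i. i \<in> I \<Longrightarrow> vs i \<noteq> []"
    and S: "\<And>x i. x \<subseteq> I \<Longrightarrow> i \<in> I \<Longrightarrow> (enc x @ suf i) \<frown> (vs i)\<^sup>\<omega> \<in> S"
    and \<eta>: "0 < \<eta>"
    and dec: "\<And>x i. x \<subseteq> I \<Longrightarrow> i \<in> I \<Longrightarrow> \<forall>\<^sub>F N in sequentially.
      \<forall>z\<in>near_optima \<eta> n d (enc x @ suf i @ concat (replicate N (vs i))). z \<in> dec i \<longleftrightarrow> i \<in> x"
  shows "ereal ((1 / 2 - \<delta>)\<^sup>2 * card I) \<le> worst_case_memory \<A> P"
proof -
  define us where "us x i N = enc x @ suf i @ concat (replicate N (vs i))" for x i N
  define good where "good x i N \<longleftrightarrow>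
    1 - \<delta> \<le> measure_pmf.prob (answer \<A> (us x i N)) (correct_answers dec x i)" for x i N
  have good: "\<forall>\<^sub>F N in sequentially. good x i N" if x: "x \<subseteq> I" and i: "i \<in> I" for x i
    using asymptotically_exact_iter_eventually[OF exact S[OF x i] vs[OF i] \<eta>] dec[OF x i]
  proof eventually_elim
    case (elim N)
    have "1 - \<delta> \<le> measure_pmf.prob (answer \<A> (us x i N)) (near_optima \<eta> n d (us x i N))"
      using elim(1) by (simp add: us_def)
    also have "\<dots> \<le> measure_pmf.prob (answer \<A> (us x i N)) (correct_answers dec x i)"
      using elim(2)
      by (intro measure_pmf.finite_measure_mono) (auto simp: us_def mem_correct_answers_iff)
    finally show ?case by (simp only: good_def)
  qed
  have "\<exists>N. \<forall>x\<in>Pow I. good x i N" if "i \<in> I" for i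
  proof -
    have "\<forall>\<^sub>F N in sequentially. \<forall>x\<in>Pow I. good x i N"
      using good that I by (intro eventually_ball_finite) auto
    then show ?thesis by (auto simp: eventually_sequentially)
  qed
  then obtain N where N: "\<And>x i. i \<in> I \<Longrightarrow> x \<subseteq> I \<Longrightarrow> good x i (N i)" by (metis PowI)
  show ?thesis
    by (rule index_memory_ge[OF I \<delta> P, where dec = dec
          and suf = "\<lambda>i. suf i @ concat (replicate (N i) (vs i))"])
       (use N in \<open>simp_all only: good_def us_def\<close>)
qed

section \<open>Encoding all bits in a single entry\<close>

lemma single_entry_near_optima:
  assumes n: "0 < n" and d: "0 < d" and a: "a \<noteq> 0"
    and z: "z \<in> near_optima \<epsilon> n d [Upd_A 0 0 a, Upd_b 0 1]"
  shows "a * z $ 0 = 1"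
proof -
  define A where "A = 0\<^sub>m n d + a \<cdot>\<^sub>m anchor_mat n d id 1"
  interpret anchored_matrix n d 1 id A "0\<^sub>m n d" a
    using n d by unfold_locales (auto simp: A_def)
  have "[Upd_A 0 0 a, Upd_b 0 1] = anchor_updates id 1 a @ [Upd_b 0 1]"
    by (simp add: anchor_updates_def)
  then have z: "z \<in> reg_approx \<epsilon> A (unit_vec n 0)"
    using z by (simp only: near_optima_def input_A_append input_b_append) (simp add: A_def)
  have Av: "A *\<^sub>v v = (a * v $ 0) \<cdot>\<^sub>v unit_vec n 0" if v: "v \<in> carrier_vec d" for v
  proof (rule eq_vecI)
    fix r assume "r < dim_vec ((a * v $ 0) \<cdot>\<^sub>v unit_vec n 0)"
    then have r: "r < n" by simp
    have "(0\<^sub>m n d *\<^sub>v v) $ r = 0" using r v by (simp add: scalar_prod_def)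
    then show "(A *\<^sub>v v) $ r = ((a * v $ 0) \<cdot>\<^sub>v unit_vec n 0) $ r"
      using mult_vec_anchored[OF v, of 0] mult_vec_unanchored[OF v r] r
      by (cases "r = 0") (auto simp: unit_vec_def)
  qed (use A_carrier in simp)
  have "A *\<^sub>v z = unit_vec n 0"
    using a d
    by (intro reg_approx_consistent[OF A_carrier _ _ _ z, where y = "(1 / a) \<cdot>\<^sub>v unit_vec d 0"])
       (auto simp: Av)
  moreover have "A *\<^sub>v z = (a * z $ 0) \<cdot>\<^sub>v unit_vec n 0"
    using z A_carrier by (intro Av) (simp add: reg_approx_def)
  ultimately have "((a * z $ 0) \<cdot>\<^sub>v unit_vec n 0) $ 0 = (unit_vec n 0 :: rvec) $ 0" by simp
  then show ?thesis using n by simp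
qed

lemma single_entry_memory_ge:
  fixes a :: "'i set \<Rightarrow> real"
  assumes exact: "asymptotically_exact \<delta> n d S \<A>" and n: "0 < n" and d: "0 < d" and \<delta>: "\<delta> \<le> 1 / 2"
    and I: "finite I" and a: "inj_on a (Pow I)" "\<And>x. x \<subseteq> I \<Longrightarrow> a x \<noteq> 0"
    and S: "\<And>x. x \<subseteq> I \<Longrightarrow> [Upd_A 0 0 (a x), Upd_b 0 1] \<in> prefixes_of S"
    and P: "\<And>x. x \<subseteq> I \<Longrightarrow> [Upd_A 0 0 (a x)] \<in> P"
  shows "ereal ((1 / 2 - \<delta>)\<^sup>2 * card I) \<le> worst_case_memory \<A> P"
proof -
  define dec where "dec i = {z :: rvec. \<exists>x\<subseteq>I. i \<in> x \<and> a x * z $ 0 = 1}" for i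
  have dec: "z \<in> dec i \<longleftrightarrow> i \<in> x" if x: "x \<subseteq> I" "a x * z $ 0 = 1" for x i and z :: rvec
  proof -
    have "x' = x" if x': "x' \<subseteq> I" "a x' * z $ 0 = 1" for x'
    proof -
      have "a x' = a x" using x(2) x'(2) by (metis mult_cancel_right mult_zero_right zero_neq_one)
      then show ?thesis using a(1) x(1) x'(1) by (auto dest: inj_onD)
    qed
    with x show ?thesis unfolding dec_def by blast
  qed
  show ?thesis
  proof (rule index_memory_ge[OF I \<delta> P, where suf = "\<lambda>_. [Upd_b 0 1]" and dec = dec])
    fix x i
    assume x: "x \<subseteq> I"
    define us where "us = [Upd_A 0 0 (a x), Upd_b 0 1]"
    obtain \<epsilon> where "1 - \<delta> \<le> measure_pmf.prob (answer \<A> us) (near_optima \<epsilon> n d us)"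
      using asymptotically_exact_prefix[OF exact S[OF x]] by (auto simp: us_def)
    also have "\<dots> \<le> measure_pmf.prob (answer \<A> us) (correct_answers dec x i)"
      using single_entry_near_optima[OF n d a(2)[OF x]] dec[OF x]
      by (intro measure_pmf.finite_measure_mono) (auto simp: us_def mem_correct_answers_iff)
    finally show "1 - \<delta> \<le> measure_pmf.prob (answer \<A> ([Upd_A 0 0 (a x)] @ [Upd_b 0 1]))
        (correct_answers dec x i)"
      by (simp add: us_def)
  qed
qed

lemma large_entry_memory_ge:
  fixes m :: nat
  assumes exact: "asymptotically_exact \<delta> n d S \<A>" and n: "0 < n" and d: "0 < d" and \<delta>: "\<delta> \<le> 1 / 2"
    and S: "\<And>a :: nat. [Upd_A 0 0 (real a), Upd_b 0 1] \<in> prefixes_of S"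
  shows "ereal ((1 / 2 - \<delta>)\<^sup>2 * m) \<le> worst_case_memory \<A> (prefixes_of S)"
proof -
  obtain f :: "nat set \<Rightarrow> nat" where f: "inj_on f (Pow {..<m})"
    by (metis finite_Pow_iff finite_lessThan finite_imp_inj_to_nat_seg)
  have "ereal ((1 / 2 - \<delta>)\<^sup>2 * card {..<m}) \<le> worst_case_memory \<A> (prefixes_of S)"
  proof (rule single_entry_memory_ge[OF exact n d \<delta>, where a = "\<lambda>x. real (Suc (f x))"])
    show "inj_on (\<lambda>x. real (Suc (f x))) (Pow {..<m})" using f by (auto simp: inj_on_def)
    show "[Upd_A 0 0 (real (Suc (f x)))] \<in> prefixes_of S" for x
      by (rule append_in_prefixes_ofD[where vs = "[Upd_b 0 1]"]) (use S[of "Suc (f x)"] in simp)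
  qed (use S in \<open>auto simp del: of_nat_Suc\<close>)
  then show ?thesis by simp
qed

section \<open>Unique turnstile updates\<close>

definition matrix_coords :: "entry_update list \<Rightarrow> (nat \<times> nat) list" where
  "matrix_coords us = concat (map (\<lambda>u. case u of Upd_A i j v \<Rightarrow> [(i, j)] | Upd_b i v \<Rightarrow> []) us)"

lemma distinct_matrix_coordsD:
  assumes "distinct (matrix_coords us)" "s < length us" "t < length us"
    and "us ! s = Upd_A i j v" "us ! t = Upd_A i j w"
  shows "s = t"
proof -
  have "(i, j) \<in> set (matrix_coords us)" if "Upd_A i j v \<in> set us" for i j v us
    using that by (auto simp: matrix_coords_def intro!: bexI[of _ "Upd_A i j v"])
  then have coords: "(i, j) \<in> set (matrix_coords us)"
    if "t < length us" "us ! t = Upd_A i j v" for i j v us t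
    using that by (metis nth_mem)
  show ?thesis
    using assms
  proof (induction us arbitrary: s t)
    case (Cons u us)
    then show ?case
      using coords[of _ us] by (cases s; cases t) (fastforce simp: matrix_coords_def)+
  qed simp
qed

lemma conc_in_unique_turnstile_streams:
  assumes us: "set us \<subseteq> admissible_updates V n d" "distinct (matrix_coords us)"
    and V: "0 \<in> V" and n: "0 < n"
  shows "us \<frown> [Upd_b 0 0]\<^sup>\<omega> \<in> unique_turnstile_streams V n d"
proof -
  let ?\<sigma> = "us \<frown> [Upd_b 0 0]\<^sup>\<omega>"
  have "?\<sigma> \<in> turnstile_streams V n d"
    using us(1) V n by (intro conc_iter_in_turnstile_streams) (auto simp: admissible_updates_def)
  moreover have "s < length us \<and> us ! s = Upd_A i j v" if "?\<sigma> s = Upd_A i j v" for s i j v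
    using that by (cases "s < length us") simp_all
  ultimately show ?thesis
    using distinct_matrix_coordsD[OF us(2)] unfolding unique_turnstile_streams_def by blast
qed

lemma matrix_coords_append [simp]: "matrix_coords (us @ vs) = matrix_coords us @ matrix_coords vs"
  by (simp add: matrix_coords_def)

lemma matrix_coords_Upd_b [simp]: "matrix_coords [Upd_b i v] = []"
  by (simp add: matrix_coords_def)

lemma matrix_coords_sign_updates [simp]:
  "matrix_coords (sign_updates m k x) = List.product [0..<m] [0..<k]"
  by (simp add: matrix_coords_def sign_updates_def comp_def case_prod_unfold)

lemma matrix_coords_anchor_updates [simp]:
  "matrix_coords (anchor_updates \<rho> k a) = map (\<lambda>c. (\<rho> c, c)) [0..<k]"
  by (simp add: matrix_coords_def anchor_updates_def comp_def)

lemma single_entry_in_prefixes_of_unique: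
  assumes "a \<in> V" "\<int> \<subseteq> V" "0 < n" "0 < d"
  shows "[Upd_A 0 0 a, Upd_b 0 1] \<in> prefixes_of (unique_turnstile_streams V n d)"
  by (rule prefix_in_prefixes_of[OF conc_in_unique_turnstile_streams])
     (use assms in \<open>auto simp: admissible_updates_def matrix_coords_def\<close>)

definition block_query :: "nat \<Rightarrow> nat \<Rightarrow> real \<Rightarrow> nat \<Rightarrow> entry_update list" where
  "block_query m k N i = anchor_updates (\<lambda>c. m + c) k N @ [Upd_b i 1]"

lemma block_query_in_unique_turnstile_streams:
  assumes V: "\<int> \<subseteq> V" and N: "N \<in> V" and dims: "m + k \<le> n" "k \<le> d" and i: "i < m"
  shows "(sign_updates m k x @ block_query m k N i) \<frown> [Upd_b 0 0]\<^sup>\<omega> \<in> unique_turnstile_streams V n d"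
proof (rule conc_in_unique_turnstile_streams)
  show "set (sign_updates m k x @ block_query m k N i) \<subseteq> admissible_updates V n d"
    using sign_updates_admissible[OF V, of m n k d]
      anchor_updates_admissible[OF N, of k "\<lambda>c. m + c" n d] i dims V
    by (auto simp: block_query_def) (auto simp: admissible_updates_def)
  show "distinct (matrix_coords (sign_updates m k x @ block_query m k N i))"
    by (auto simp: block_query_def distinct_product distinct_map inj_on_def)
qed (use V dims i in auto)

lemma block_query_near_optima:
  fixes \<epsilon> :: real
  assumes dims: "m + k \<le> n" "k \<le> d" and i: "i < m" and j: "j < k"
    and N: "0 < N" "8 * (real n * (real d)\<^sup>2) \<le> N\<^sup>2" and \<epsilon>: "0 \<le> \<epsilon>" "48 * real n * N\<^sup>2 * \<epsilon> \<le> 1"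
    and z: "z \<in> near_optima \<epsilon> n d
      (sign_updates m k x @ block_query m k N i @ concat (replicate t [Upd_b 0 0]))"
  shows "0 < z $ j \<longleftrightarrow> (i, j) \<in> x"
proof -
  define B where "B = input_A n d (sign_updates m k x)"
  define A where "A = B + N \<cdot>\<^sub>m anchor_mat n d (\<lambda>c. m + c) k"
  have B: "B \<in> carrier_mat n d" by (simp add: B_def)
  interpret anchored_block n d k "\<lambda>c. m + c" A B N
    using dims B N
    by unfold_locales (auto simp: inj_on_def A_def B_def index_input_A_sign_updates bit_sign_def)
  have "real t \<cdot>\<^sub>v (0 \<cdot>\<^sub>v unit_vec n 0) = 0\<^sub>v n" by (rule eq_vecI) auto
  then have "z \<in> reg_approx \<epsilon> A (unit_vec n i)"
    using z B unfolding near_optima_def block_query_def input_A_append input_b_append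
      input_A_concat_replicate input_b_concat_replicate
    by (simp add: A_def flip: B_def)
  then have "\<bar>z $ j - B $$ (i, j) / N\<^sup>2\<bar> < 1 / N\<^sup>2"
    using dims i j \<epsilon> by (intro reg_approx_unit_query) auto
  moreover have "B $$ (i, j) = bit_sign x (i, j)"
    using dims i j by (simp add: B_def index_input_A_sign_updates)
  ultimately show ?thesis
    by (auto simp: bit_sign_def abs_less_iff split: if_splits)
qed

lemma unique_block_memory_ge:
  assumes exact: "asymptotically_exact \<delta> n d (unique_turnstile_streams V n d) \<A>"
    and \<delta>: "\<delta> \<le> 1 / 2" and V: "\<int> \<subseteq> V"
    and dims: "m + k \<le> n" "k \<le> d" "0 < m" "0 < k"
  shows "ereal ((1 / 2 - \<delta>)\<^sup>2 * (m * k)) \<le>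
    worst_case_memory \<A> (small_prefixes_of (n * d) (unique_turnstile_streams V n d))"
proof -
  define N where "N = 3 * (real n * real d)"
  have N: "N \<in> V" "0 < N" using V dims by (auto simp: N_def)
  have "real n \<le> (real n)\<^sup>2" by (cases n) (simp_all add: power2_eq_square)
  then have "8 * (real n * (real d)\<^sup>2) \<le> 9 * ((real n)\<^sup>2 * (real d)\<^sup>2)" by (intro mult_mono) auto
  then have N_large: "8 * (real n * (real d)\<^sup>2) \<le> N\<^sup>2" by (simp add: N_def power_mult_distrib)
  define \<epsilon> where "\<epsilon> = 1 / (48 * real n * N\<^sup>2)"
  have \<epsilon>: "0 < \<epsilon>" "48 * real n * N\<^sup>2 * \<epsilon> \<le> 1" using N(2) dims by (simp_all add: \<epsilon>_def)
  note S = block_query_in_unique_turnstile_streams[OF V N(1) dims(1,2)]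
  have "ereal ((1 / 2 - \<delta>)\<^sup>2 * card ({..<m} \<times> {..<k})) \<le>
    worst_case_memory \<A> (small_prefixes_of (n * d) (unique_turnstile_streams V n d))"
  proof (rule asymptotic_index_memory_ge[OF exact \<delta>, where enc = "sign_updates m k"
        and suf = "\<lambda>(i, j). block_query m k N i" and vs = "\<lambda>_. [Upd_b 0 0]" and \<eta> = \<epsilon>
        and dec = "\<lambda>(i, j). {z. 0 < z $ j}"])
    show "sign_updates m k x \<in> small_prefixes_of (n * d) (unique_turnstile_streams V n d)" for x
      using dims S[of 0 x, THEN prefix_in_prefixes_of, THEN append_in_prefixes_ofD]
      by (intro sign_updates_in_small_prefixes_of) auto
    fix x and p :: "nat \<times> nat"
    assume "p \<in> {..<m} \<times> {..<k}"
    then obtain i j where p: "p = (i, j)" "i < m" "j < k" by auto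
    show "(sign_updates m k x @ (case p of (i, j) \<Rightarrow> block_query m k N i)) \<frown> [Upd_b 0 0]\<^sup>\<omega>
        \<in> unique_turnstile_streams V n d"
      using S[OF p(2)] by (simp only: p(1) prod.case)
    show "\<forall>\<^sub>F t in sequentially. \<forall>z\<in>near_optima \<epsilon> n d
          (sign_updates m k x @ (case p of (i, j) \<Rightarrow> block_query m k N i)
            @ concat (replicate t [Upd_b 0 0])).
        z \<in> (case p of (i, j) \<Rightarrow> {z. 0 < z $ j}) \<longleftrightarrow> p \<in> x"
      using block_query_near_optima[OF dims(1,2) p(2,3) N(2) N_large _ \<epsilon>(2)] \<epsilon>(1)
      by (intro always_eventually) (auto simp: p(1) simp del: concat_replicate_single)
  qed (use \<epsilon> in auto)
  then show ?thesis by (simp add: card_cartesian_product)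
qed

lemma unique_one_by_one_memory_ge:
  assumes exact: "asymptotically_exact \<delta> 1 1 (unique_turnstile_streams V 1 1) \<A>"
    and \<delta>: "\<delta> \<le> 1 / 2" and V: "\<int> \<subseteq> V"
  shows "ereal ((1 / 2 - \<delta>)\<^sup>2) \<le>
    worst_case_memory \<A> (small_prefixes_of 1 (unique_turnstile_streams V 1 1))"
proof -
  let ?a = "\<lambda>x. bit_sign x ()"
  have S: "[Upd_A 0 0 (?a x), Upd_b 0 1] \<in> prefixes_of (unique_turnstile_streams V 1 1)" for x
    using V by (intro single_entry_in_prefixes_of_unique) (auto simp: bit_sign_def)
  have "ereal ((1 / 2 - \<delta>)\<^sup>2 * card {()}) \<le>
    worst_case_memory \<A> (small_prefixes_of 1 (unique_turnstile_streams V 1 1))"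
  proof (rule single_entry_memory_ge[OF exact _ _ \<delta>, where a = ?a])
    show "inj_on ?a (Pow {()})"
      by (auto simp: inj_on_def bit_sign_def split: if_splits)
    show "[Upd_A 0 0 (?a x)] \<in> small_prefixes_of 1 (unique_turnstile_streams V 1 1)" for x
      using append_in_prefixes_ofD[of "[Upd_A 0 0 (?a x)]" "[Upd_b 0 1]"] S[of x]
      by (auto simp: small_prefixes_of_def bit_sign_def)
  qed (use S in \<open>auto simp: bit_sign_def\<close>)
  then show ?thesis by simp
qed

lemma unique_small_memory_ge:
  assumes exact: "asymptotically_exact \<delta> n d (unique_turnstile_streams V n d) \<A>"
    and \<delta>: "\<delta> \<le> 1 / 2" and V: "\<int> \<subseteq> V" and d: "1 \<le> d" "d \<le> n"
  shows "ereal ((1 / 2 - \<delta>)\<^sup>2 / 6 * n * d) \<le>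
    worst_case_memory \<A> (small_prefixes_of (n * d) (unique_turnstile_streams V n d))"
proof (cases "n = 1")
  case True
  with d have nd: "n = 1" "d = 1" by auto
  have "ereal ((1 / 2 - \<delta>)\<^sup>2 / 6 * n * d) \<le> ereal ((1 / 2 - \<delta>)\<^sup>2)" by (simp add: nd)
  also have "\<dots> \<le> worst_case_memory \<A> (small_prefixes_of (n * d) (unique_turnstile_streams V n d))"
    using unique_one_by_one_memory_ge[of \<delta> V \<A>] exact \<delta> V by (simp add: nd)
  finally show ?thesis .
next
  case False
  define m where "m = n div 2"
  define k where "k = (d + 1) div 2"
  have n: "2 \<le> n" using False d by simp
  have dims: "m + k \<le> n" "k \<le> d" "0 < m" "0 < k" using n d by (auto simp: m_def k_def)
  have "n \<le> 3 * m" "d \<le> 2 * k" using n by (auto simp: m_def k_def)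
  then have "n * d \<le> 3 * m * (2 * k)" by (rule mult_le_mono)
  then have "real n * real d \<le> 6 * real (m * k)" by (simp flip: of_nat_mult)
  then have "(1 / 2 - \<delta>)\<^sup>2 / 6 * (real n * real d) \<le> (1 / 2 - \<delta>)\<^sup>2 / 6 * (6 * real (m * k))"
    by (intro mult_left_mono) auto
  then have "ereal ((1 / 2 - \<delta>)\<^sup>2 / 6 * n * d) \<le> ereal ((1 / 2 - \<delta>)\<^sup>2 * (m * k))"
    by (simp add: mult.assoc)
  also have "\<dots> \<le> worst_case_memory \<A> (small_prefixes_of (n * d) (unique_turnstile_streams V n d))"
    by (rule unique_block_memory_ge[OF exact \<delta> V dims])
  finally show ?thesis .
qed

section \<open>Turnstile updates with diverging smallest singular value\<close>

definition anchor_cycle :: "(nat \<Rightarrow> nat) \<Rightarrow> nat \<Rightarrow> nat \<Rightarrow> entry_update list" where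
  "anchor_cycle \<rho> k i = anchor_updates \<rho> k 1 @ [Upd_b i 1]"

lemma input_anchor_cycle [simp]:
  "input_A n d (anchor_cycle \<rho> k i) = anchor_mat n d \<rho> k"
  "input_b n (anchor_cycle \<rho> k i) = unit_vec n i"
  by (auto simp: anchor_cycle_def input_A_append input_b_append intro: eq_matI eq_vecI)

lemma input_A_conc_iter:
  assumes "vs \<noteq> []"
  shows "input_A n d (stream_prefix (us \<frown> vs\<^sup>\<omega>) (t + length us))
    = (input_A n d us + input_A n d (take (t mod length vs) vs))
      + of_nat (t div length vs) \<cdot>\<^sub>m input_A n d vs"
  unfolding add.commute[of t] stream_prefix_conc stream_prefix_iter_div_mod[OF assms]
    input_A_append input_A_concat_replicate
  by (rule eq_matI) auto

lemma abs_input_A_append_take_le: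
  assumes "r < n" "c < d"
  shows "\<bar>input_A n d (us @ take m vs) $$ (r, c)\<bar> \<le> (\<Sum>u\<leftarrow>us @ vs. \<bar>upd_value u\<bar>)"
proof -
  have "(\<Sum>u\<leftarrow>vs. \<bar>upd_value u\<bar>) = (\<Sum>u\<leftarrow>take m vs. \<bar>upd_value u\<bar>) + (\<Sum>u\<leftarrow>drop m vs. \<bar>upd_value u\<bar>)"
    by (metis append_take_drop_id map_append sum_list.append)
  moreover have "0 \<le> (\<Sum>u\<leftarrow>drop m vs. \<bar>upd_value u\<bar>)" by (rule sum_list_nonneg) auto
  ultimately show ?thesis using abs_input_A_le[OF assms, of "us @ take m vs"] by simp
qed

lemma filterlim_smallest_singular_value_iter:
  assumes vs: "vs \<noteq> []" "input_A n d vs = anchor_mat n d \<rho> (min n d)"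
    and \<rho>: "\<rho> permutes {..<n}" and n: "0 < n" and d: "0 < d"
  shows "filterlim (\<lambda>t. smallest_singular_value (input_A n d (stream_prefix (us \<frown> vs\<^sup>\<omega>) t)))
    at_top sequentially" (is "filterlim ?\<sigma> _ _")
proof -
  have "filterlim (\<lambda>t. ?\<sigma> (t + length us)) at_top sequentially"
  proof (rule filterlim_smallest_singular_value_anchored[OF _ _ _ \<rho> n d])
    show "input_A n d (stream_prefix (us \<frown> vs\<^sup>\<omega>) (t + length us)) =
        input_A n d (us @ take (t mod length vs) vs)
          + of_nat (t div length vs) \<cdot>\<^sub>m anchor_mat n d \<rho> (min n d)" for t
      unfolding input_A_conc_iter[OF vs(1)] input_A_append vs(2) ..
    show "filterlim (\<lambda>t. real (t div length vs)) at_top sequentially"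
      using vs(1)
      by (intro filterlim_compose[OF filterlim_real_sequentially]
          filterlim_at_top_div_const_nat) simp
  qed (use abs_input_A_append_take_le in auto)
  then show ?thesis
    by (simp add: filterlim_at_top eventually_sequentially_seg[of "\<lambda>t. _ \<le> ?\<sigma> t" "length us"])
qed

lemma conc_in_diverging_turnstile_streams:
  assumes us: "set us \<subseteq> admissible_updates V n d" and V: "1 \<in> V" and n: "0 < n" and d: "0 < d"
    and i: "i < n" and \<rho>: "\<rho> permutes {..<n}"
  shows "us \<frown> (anchor_cycle \<rho> (min n d) i)\<^sup>\<omega> \<in> diverging_turnstile_streams V n d"
proof -
  have vs: "anchor_cycle \<rho> (min n d) i \<noteq> []" by (simp add: anchor_cycle_def)
  have "set (anchor_cycle \<rho> (min n d) i) \<subseteq> admissible_updates V n d"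
    using anchor_updates_admissible[OF V, of "min n d" \<rho> n d] permutes_in_image[OF \<rho>] i V
    by (auto simp: anchor_cycle_def) (auto simp: admissible_updates_def)
  with us vs have "us \<frown> (anchor_cycle \<rho> (min n d) i)\<^sup>\<omega> \<in> turnstile_streams V n d"
    by (intro conc_iter_in_turnstile_streams) auto
  then show ?thesis
    using filterlim_smallest_singular_value_iter[OF vs _ \<rho> n d]
    by (simp add: diverging_turnstile_streams_def)
qed

lemma single_entry_in_prefixes_of_diverging:
  assumes "a \<in> V" "\<int> \<subseteq> V" "0 < n" "0 < d"
  shows "[Upd_A 0 0 a, Upd_b 0 1] \<in> prefixes_of (diverging_turnstile_streams V n d)"
  by (rule prefix_in_prefixes_of[OF conc_in_diverging_turnstile_streams[where \<rho> = id and i = 0]])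
     (use assms in \<open>auto simp: admissible_updates_def permutes_id\<close>)

lemma anchor_cycle_near_optima:
  fixes \<epsilon> :: real
  assumes d: "d \<le> n" and i: "i < n" and j: "j < d"
    and N: "96 * (real n)\<^sup>2 \<le> real N" and \<epsilon>: "0 \<le> \<epsilon>" "192 * real n * \<epsilon> \<le> 1"
    and z: "z \<in> near_optima \<epsilon> n d (sign_updates n d x
      @ concat (replicate N (anchor_cycle (Transposition.transpose i j) d i)))"
  shows "z $ j < 1 \<longleftrightarrow> (i, j) \<in> x"
proof -
  define \<rho> where "\<rho> = Transposition.transpose i j"
  have \<rho>: "\<rho> permutes {..<n}" using i j d by (auto simp: \<rho>_def intro: permutes_swap_id)
  have \<rho>_j: "\<rho> j = i" by (simp add: \<rho>_def)
  define B where "B = input_A n d (sign_updates n d x)"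
  define A where "A = B + real N \<cdot>\<^sub>m anchor_mat n d \<rho> d"
  have B: "B \<in> carrier_mat n d" by (simp add: B_def)
  have "1 \<le> real n" using i by simp
  then have "real n \<le> (real n)\<^sup>2" using self_le_power[of "real n" 2] by simp
  with N d \<open>1 \<le> real n\<close> have N_ge: "2 * d \<le> real N" "0 < real N" by linarith+
  interpret anchored_columns n d \<rho> A B "real N"
    using permutes_inj_on[OF \<rho>] permutes_in_image[OF \<rho>] B d N_ge
    by unfold_locales (auto simp: A_def B_def index_input_A_sign_updates bit_sign_def)
  have "z \<in> reg_approx \<epsilon> A (real N \<cdot>\<^sub>v unit_vec n (\<rho> j))"
    using z unfolding near_optima_def input_A_append input_b_append
      input_A_concat_replicate input_b_concat_replicate
    by (simp add: A_def \<rho>_j flip: B_def \<rho>_def)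
  then have "\<bar>z $ j - (1 - B $$ (\<rho> j, j) / N)\<bar> < 1 / N"
    using N j \<epsilon> by (intro reg_approx_anchored_query) auto
  moreover have "B $$ (\<rho> j, j) = bit_sign x (i, j)"
    using i j by (simp add: B_def index_input_A_sign_updates \<rho>_j)
  ultimately show ?thesis
    by (auto simp: bit_sign_def abs_less_iff split: if_splits)
qed

lemma diverging_small_memory_ge:
  assumes exact: "asymptotically_exact \<delta> n d (diverging_turnstile_streams V n d) \<A>"
    and \<delta>: "\<delta> \<le> 1 / 2" and V: "\<int> \<subseteq> V" and d: "1 \<le> d" "d \<le> n"
  shows "ereal ((1 / 2 - \<delta>)\<^sup>2 * n * d) \<le>
    worst_case_memory \<A> (small_prefixes_of (n * d) (diverging_turnstile_streams V n d))"
proof -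
  define \<epsilon> :: real where "\<epsilon> = 1 / (192 * real n)"
  have \<epsilon>: "0 < \<epsilon>" "192 * real n * \<epsilon> \<le> 1" using d by (simp_all add: \<epsilon>_def)
  define vs where "vs = (\<lambda>(i, j). anchor_cycle (Transposition.transpose i j) d i)"
  have S: "sign_updates n d x \<frown> (vs p)\<^sup>\<omega> \<in> diverging_turnstile_streams V n d"
    if mem: "p \<in> {..<n} \<times> {..<d}" for x p
  proof -
    obtain i j where p: "p = (i, j)" "i < n" "j < d" using mem by auto
    have "Transposition.transpose i j permutes {..<n}" using p d by (intro permutes_swap_id) auto
    then have "sign_updates n d x \<frown> (anchor_cycle (Transposition.transpose i j) (min n d) i)\<^sup>\<omega>
        \<in> diverging_turnstile_streams V n d"
      using V d p sign_updates_admissible[OF V] by (intro conc_in_diverging_turnstile_streams) auto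
    then show ?thesis using d by (simp add: p(1) vs_def min_absorb2)
  qed
  have "ereal ((1 / 2 - \<delta>)\<^sup>2 * card ({..<n} \<times> {..<d})) \<le>
    worst_case_memory \<A> (small_prefixes_of (n * d) (diverging_turnstile_streams V n d))"
  proof (rule asymptotic_index_memory_ge[OF exact \<delta>, where enc = "sign_updates n d"
        and suf = "\<lambda>_. []" and vs = vs and \<eta> = \<epsilon> and dec = "\<lambda>(i, j). {z. z $ j < 1}"])
    show "sign_updates n d x \<in> small_prefixes_of (n * d) (diverging_turnstile_streams V n d)" for x
      using d S[of "(0, 0)" x, THEN prefix_in_prefixes_of]
      by (intro sign_updates_in_small_prefixes_of) auto
    fix x and p :: "nat \<times> nat"
    assume "p \<in> {..<n} \<times> {..<d}"
    then obtain i j where p: "p = (i, j)" "i < n" "j < d" by auto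
    have "\<forall>\<^sub>F N in sequentially. 96 * (real n)\<^sup>2 \<le> real N"
      using filterlim_real_sequentially unfolding filterlim_at_top by blast
    then show "\<forall>\<^sub>F N in sequentially.
        \<forall>z\<in>near_optima \<epsilon> n d (sign_updates n d x @ [] @ concat (replicate N (vs p))).
          z \<in> (case p of (i, j) \<Rightarrow> {z. z $ j < 1}) \<longleftrightarrow> p \<in> x"
    proof eventually_elim
      case (elim N)
      then show ?case
        using anchor_cycle_near_optima[OF d(2) p(2,3) elim _ \<epsilon>(2)] \<epsilon>(1) by (auto simp: p(1) vs_def)
    qed
  qed (use \<epsilon> S in \<open>auto simp: vs_def anchor_cycle_def\<close>)
  then show ?thesis by (simp add: card_cartesian_product mult.assoc)
qed

section \<open>The three lower bounds\<close>

lemma needs_Omega_nd_memory_mono: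
  assumes sub: "\<And>V n d. \<S>' V n d \<subseteq> \<S> V n d" and needs: "needs_Omega_nd_memory \<delta> \<S>'"
  shows "needs_Omega_nd_memory \<delta> \<S>"
proof -
  have exact: "asymptotically_exact \<delta> n d (\<S>' V n d) \<A>"
    if "asymptotically_exact \<delta> n d (\<S> V n d) \<A>" for V n d \<A>
    using that sub unfolding asymptotically_exact_def by blast
  have memory_mono: "worst_case_memory \<A> P \<le> worst_case_memory \<A> Q" if "P \<subseteq> Q" for \<A> P Q
    unfolding worst_case_memory_def using that by (rule SUP_subset_mono) simp
  have prefixes: "prefixes_of (\<S>' V n d) \<subseteq> prefixes_of (\<S> V n d)" for V n d
    using sub unfolding prefixes_of_def by blast
  then have "small_prefixes_of T (\<S>' V n d) \<subseteq> small_prefixes_of T (\<S> V n d)" for T V n d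
    by (auto simp: small_prefixes_of_def)
  then show ?thesis
    using needs exact memory_mono prefixes unfolding needs_Omega_nd_memory_def
    by (meson order_trans)
qed

lemma needs_Omega_nd_memoryI:
  assumes \<delta>: "\<delta> \<le> 1 / 2" and c: "0 < c" "c \<le> (1 / 2 - \<delta>)\<^sup>2"
    and large: "\<And>V n d a. \<int> \<subseteq> V \<Longrightarrow> a \<in> V \<Longrightarrow> 0 < n \<Longrightarrow> 0 < d \<Longrightarrow>
      [Upd_A 0 0 a, Upd_b 0 1] \<in> prefixes_of (\<S> V n d)"
    and small: "\<And>V n d \<A>. asymptotically_exact \<delta> n d (\<S> V n d) \<A> \<Longrightarrow> \<int> \<subseteq> V \<Longrightarrow> 1 \<le> d \<Longrightarrow> d \<le> n \<Longrightarrow>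
      ereal (c * n * d) \<le> worst_case_memory \<A> (small_prefixes_of (n * d) (\<S> V n d))"
  shows "needs_Omega_nd_memory \<delta> \<S>"
  unfolding needs_Omega_nd_memory_def
proof (intro exI[of _ c] conjI allI impI; (elim conjE)?)
  fix V n d \<A>
  assume V: "\<int> \<subseteq> V" and nd: "1 \<le> n" "1 \<le> d" and exact: "asymptotically_exact \<delta> n d (\<S> V n d) \<A>"
  have "ereal (c * n * d) \<le> ereal ((1 / 2 - \<delta>)\<^sup>2 * real (n * d))"
    using mult_right_mono[OF c(2), of "real (n * d)"] by (simp add: mult.assoc)
  also have "\<dots> \<le> worst_case_memory \<A> (prefixes_of (\<S> V n d))"
    using V nd by (intro large_entry_memory_ge[OF exact] \<delta> large) auto
  finally show "ereal (c * n * d) \<le> worst_case_memory \<A> (prefixes_of (\<S> V n d))" .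
  show "ereal (c * n * d) \<le> worst_case_memory \<A> (small_prefixes_of (n * d) (\<S> V n d))"
    if "d \<le> n"
    using exact V nd(2) that by (rule small)
qed (rule c)

theorem theorem14:
  fixes \<delta> :: real
  assumes "0 \<le> \<delta>" and "\<delta> < 1 / 2"
  shows "needs_Omega_nd_memory \<delta> turnstile_streams
       \<and> needs_Omega_nd_memory \<delta> unique_turnstile_streams
       \<and> needs_Omega_nd_memory \<delta> diverging_turnstile_streams"
proof (intro conjI)
  have \<delta>: "\<delta> \<le> 1 / 2" and pos: "0 < (1 / 2 - \<delta>)\<^sup>2" using assms by simp_all
  show unique: "needs_Omega_nd_memory \<delta> unique_turnstile_streams"
    using \<delta> pos single_entry_in_prefixes_of_unique unique_small_memory_ge[OF _ \<delta>]
    by (intro needs_Omega_nd_memoryI[where c = "(1 / 2 - \<delta>)\<^sup>2 / 6"]) auto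
  show "needs_Omega_nd_memory \<delta> turnstile_streams"
    by (rule needs_Omega_nd_memory_mono[OF _ unique]) (auto simp: unique_turnstile_streams_def)
  show "needs_Omega_nd_memory \<delta> diverging_turnstile_streams"
    using \<delta> pos single_entry_in_prefixes_of_diverging diverging_small_memory_ge[OF _ \<delta>]
    by (intro needs_Omega_nd_memoryI[where c = "(1 / 2 - \<delta>)\<^sup>2"]) auto
qed

end
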